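(* Let $f$ be a continuous function on $[-1,1]$ such that $\lambda(f,\delta)=o(\delta^{1/2})$ as $\delta\to0$. Let $d\mu_1(x)=w(x)\,dx$ be a finite positive Borel measure on $[-1,1]$ satisfying the Szegő condition $\int_{-1}^1\frac{\log w(x)}{\sqrt{1-x^2}}\,dx>-\infty$. Assume that the function $w(x)\sqrt{1-x^2}$ is positive on $[-1,1]$ and analytic in an open set containing $[-1,1]$. Let $$d\mu_2(x)=(1-x^2)\,d\mu_1(x),\quad d\mu_3(x)=(1-x)\,d\mu_1(x),\quad d\mu_4(x)=(1+x)\,d\mu_1(x),$$ and for $i=2,3,4$ let $P_n(x,\mu_i)$ be the monic orthogonal polynomial of degree $n$ with respect to $\mu_i$. For each $n$ consider the Lagrange interpolation polynomial of $f$ for each of the following nodal systems: (i) the $n$ zeros of $P_n(x,\mu_2)$ together with $1$ and $-1$ (interpolation polynomial of degree at most $n+1$); (ii) the $n$ zeros of $P_n(x,\mu_3)$ together with $1$ (interpolation polynomial of degree at most $n$); (iii) the $n$ zeros of $P_n(x,\mu_4)$ together with $-1$ (interpolation polynomial of degree at most $n$). Then in each of the three cases the corresponding Lagrange interpolation polynomials converge to $f$ uniformly on $[-1,1]$ as $n\to\infty$.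
   Context: The modulus of continuity of $f$ is $\lambda(f,\delta)=\sup\{|f(s)-f(t)|:s,t\in[-1,1],\ |s-t|<\delta\}$; $f$ may be real- or complex-valued. The assumption on $w(x)\sqrt{1-x^2}$ means that there are an open set $U\subset\mathbb{C}$ containing $[-1,1]$ and an analytic function $h$ on $U$ with $h(x)>0$ for all $x\in[-1,1]$ and $h(x)=w(x)\sqrt{1-x^2}$ for $x\in(-1,1)$. The Lagrange interpolation polynomial of $f$ for a system of $m$ distinct nodes is the unique polynomial of degree at most $m-1$ that agrees with $f$ at the nodes. *)

theory Defs
  imports
    "HOL-Analysis.Analysis"
    "HOL-Library.Landau_Symbols"
    "HOL-Computational_Algebra.Polynomial"
begin

definition modulus_cont :: "(real \<Rightarrow> complex) \<Rightarrow> real \<Rightarrow> real" where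
  "modulus_cont f \<delta> =
     Sup {cmod (f s - f t) | s t. s \<in> {-1..1} \<and> t \<in> {-1..1} \<and> \<bar>s - t\<bar> < \<delta>}"

definition weight_measure :: "(real \<Rightarrow> real) \<Rightarrow> real measure" where
  "weight_measure w = density (restrict_space lborel {-1..1}) (\<lambda>x. ennreal (w x))"

text \<open>
  The integral of \<open>log w(x) / sqrt(1 - x^2)\<close> exceeds minus infinity iff the negative part of the
  integrand has finite integral. The truncation \<open>ennreal y = 0\<close> for \<open>y \<le> 0\<close> selects the negative
  part. Positivity of \<open>w\<close> almost everywhere is stated separately because \<open>log 0\<close> must count as
  minus infinity, whereas \<open>ln\<close> is total on the reals.
\<close>

definition szego_condition :: "(real \<Rightarrow> real) \<Rightarrow> bool" where
  "szego_condition w \<longleftrightarrow>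
     (AE x in restrict_space lborel {-1..1}. 0 < w x) \<and>
     (\<integral>\<^sup>+ x. ennreal (- (ln (w x) / sqrt (1 - x\<^sup>2))) \<partial>restrict_space lborel {-1..1}) < \<infinity>"

definition is_monic_orthogonal_poly :: "real measure \<Rightarrow> nat \<Rightarrow> real poly \<Rightarrow> bool" where
  "is_monic_orthogonal_poly M n p \<longleftrightarrow>
     degree p = n \<and> lead_coeff p = 1 \<and>
     (\<forall>q. degree q < n \<longrightarrow> (\<integral>x. poly p x * poly q x \<partial>M) = 0)"

definition monic_orthogonal_poly :: "real measure \<Rightarrow> nat \<Rightarrow> real poly" where
  "monic_orthogonal_poly M n = (THE p. is_monic_orthogonal_poly M n p)"

definition poly_zeros :: "real poly \<Rightarrow> real set" where
  "poly_zeros p = {x. poly p x = 0}"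

text \<open>
  Here \<open>X\<close> is a system of \<open>m \<ge> 1\<close> distinct nodes. The polynomial is not determined if \<open>X\<close> has
  fewer than \<open>m\<close> elements.
\<close>

definition lagrange_poly :: "nat \<Rightarrow> real set \<Rightarrow> (real \<Rightarrow> complex) \<Rightarrow> complex poly" where
  "lagrange_poly m X f =
     (THE p. degree p \<le> m - 1 \<and> (\<forall>x\<in>X. poly p (complex_of_real x) = f x))"

end

theory Submission
  imports Defs "HOL-Computational_Algebra.Fundamental_Theorem_Algebra"
begin

text \<open>
  The nodes carry a Gauss--Radau or Gauss--Lobatto quadrature of the measure \<open>\<mu>1\<close> with nonnegative
  weights \<open>\<lambda>\<close>. For a polynomial \<open>D\<close> of degree less than the number of nodes, \<open>D(x)\<^sup>2\<close> is at most
  \<open>K \<integral> D\<^sup>2 d\<mu>1\<close>, which is at most \<open>K max \<lambda> \<Sum> D(y)\<^sup>2\<close> over the nodes \<open>y\<close>; here \<open>K\<close> bounds the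
  Christoffel--Darboux kernel on the diagonal. As \<open>w(x) sqrt(1 - x\<^sup>2)\<close> lies between two positive constants,
  comparison with the Chebyshev weight gives \<open>K = O(n)\<close> and \<open>max \<lambda> = O(1/n)\<close>, so the Lebesgue constants
  are \<open>O(sqrt n)\<close>. By Jackson's theorem \<open>f\<close> is approximated by polynomials of degree \<open>n\<close> with error
  \<open>o(1 / sqrt n)\<close>, which compensates this growth.
\<close>

text \<open>The modified measures differ from \<mu>1 by a factor that vanishes at the prescribed
  endpoints. Hence the nodal polynomial, the endpoint factor times the orthogonal polynomial, is
  orthogonal under \<mu>1 to every polynomial of degree less than n. This is why the quadrature
  concerns \<mu>1 and is exact almost up to degree 2n with only n + 1 or n + 2 nodes. With both
  endpoints prescribed, D^2 may exceed the degree of exactness by one, and only the inequality that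
  the estimate needs survives. Asymptotics of orthogonal polynomials are avoided: the bounds for the
  kernel and for the weights depend monotonically on the measure, so they carry over from the
  Chebyshev weight, for which an explicit orthogonal basis is at hand. Passing through squares costs
  a factor sqrt n, from the number of nodes; this is exactly the rate that o(\<delta>^(1/2))
  compensates at the scale \<delta> = 1/n.\<close>

lemma degree_root_prod:
  "finite X \<Longrightarrow> degree (\<Prod>x\<in>X. [:- x, 1:]) = card X" for X :: "'a::field set"
  by (subst degree_prod_sum_eq) auto

lemma interpolating_poly_exists:
  fixes X :: "'a::field set" and f :: "'a \<Rightarrow> 'a"
  assumes "finite X" "X \<noteq> {}"
  shows "\<exists>p. degree p < card X \<and> (\<forall>x\<in>X. poly p x = f x)"
  using assms
proof (induction X rule: finite_ne_induct)
  case (singleton x)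
  show ?case by (rule exI[of _ "[:f x:]"]) simp
next
  case (insert a F)
  then obtain p where p: "degree p < card F" "\<And>x. x \<in> F \<Longrightarrow> poly p x = f x" by blast
  define w where "w = (\<Prod>x\<in>F. [:- x, 1:])"
  have w: "degree w = card F" "\<And>x. poly w x = 0 \<longleftrightarrow> x \<in> F"
    using insert.hyps degree_root_prod[of F] by (auto simp: w_def poly_prod)
  let ?p = "p + smult ((f a - poly p a) / poly w a) w"
  have "degree ?p \<le> card F"
    using p(1) w(1) by (intro degree_add_le) (auto intro: order.trans[OF degree_smult_le])
  moreover have "poly ?p x = f x" if "x \<in> insert a F" for x
    using that p(2) w(2) insert.hyps by auto
  ultimately show ?case using insert.hyps by (intro exI[of _ ?p]) simp
qed

section \<open>Real-rootedness of real polynomials\<close>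

lemma map_poly_of_real_add:
  "map_poly of_real (p + q) = map_poly of_real p + (map_poly of_real q :: complex poly)"
  by (intro poly_eqI) (simp add: coeff_map_poly)

lemma map_poly_of_real_mult:
  "map_poly of_real (p * q) = map_poly of_real p * (map_poly of_real q :: complex poly)"
  by (intro poly_eqI) (simp add: coeff_map_poly coeff_mult)

lemma poly_map_poly_of_real:
  "poly (map_poly of_real p :: complex poly) (of_real x) = of_real (poly p x)"
  by (induction p) (simp_all add: map_poly_pCons)

text \<open>The divisor is (t - z)(t - conj z). The remainder has real coefficients, degree at most
  1 and the root z; a real a + b t vanishes at a nonreal z only if a = b = 0.\<close>

lemma real_poly_nonreal_root_dvd:
  fixes p :: "real poly" and z :: complex
  assumes "poly (map_poly of_real p) z = 0" "Im z \<noteq> 0"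
  shows "[:(cmod z)\<^sup>2, - 2 * Re z, 1:] dvd p"
proof -
  let ?d = "[:(cmod z)\<^sup>2, - 2 * Re z, 1:]"
  let ?r = "p mod ?d"
  have d: "poly (map_poly of_real ?d) z = 0"
    unfolding cmod_power2
    by (simp add: map_poly_pCons complex_eq_iff power2_eq_square algebra_simps)
  have "map_poly of_real p = map_poly of_real (p div ?d * ?d + ?r)" by (simp only: div_mult_mod_eq)
  also have "\<dots> = map_poly of_real (p div ?d) * map_poly of_real ?d + (map_poly of_real ?r :: complex poly)"
    by (simp only: map_poly_of_real_add map_poly_of_real_mult)
  finally have r: "poly (map_poly of_real ?r) z = 0"
    using assms(1) d by simp
  have "degree ?r \<le> 1"
    using degree_mod_less'[of ?d p] by (cases "?r = 0") auto
  then obtain a b where ab: "?r = [:a, b:]"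
    using degree_eq_zeroE[of ?r]
    by (metis One_nat_def degree1_coeffs le_SucE le_zero_eq degree_0_id pCons_0_0)
  have "?r = 0" using r assms(2) unfolding ab by (auto simp: map_poly_pCons complex_eq_iff)
  then show ?thesis by auto
qed

text \<open>Too few distinct real roots can only be due to a nonreal conjugate pair or a repeated
  root. Each yields a quadratic divisor without negative values, (x - Re z)^2 + (Im z)^2 or (x -
  a)^2. The hypothesis has the form that orthogonality delivers.\<close>

lemma card_roots_eq_degree:
  fixes p :: "real poly"
  assumes "p \<noteq> 0" and "\<And>d. d dvd p \<Longrightarrow> degree d = 2 \<Longrightarrow> \<exists>x. poly d x < 0"
  shows "card {x. poly p x = 0} = degree p"
  using assms
proof (induction "degree p" arbitrary: p)
  case 0
  then show ?case by (auto elim: degree_eq_zeroE)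
next
  case (Suc n)
  have "degree (map_poly of_real p :: complex poly) = degree p" by (rule degree_map_poly) simp
  then have "\<not> constant (poly (map_poly of_real p :: complex poly))"
    using Suc.hyps(2) by (simp add: constant_degree)
  then obtain z :: complex where z: "poly (map_poly of_real p) z = 0"
    using fundamental_theorem_of_algebra by blast
  have Im: "Im z = 0"
  proof (rule ccontr)
    assume "Im z \<noteq> 0"
    from Suc.prems(2)[OF real_poly_nonreal_root_dvd[OF z this]]
    obtain x where "poly [:(cmod z)\<^sup>2, - 2 * Re z, 1:] x < 0" by auto
    moreover have "poly [:(cmod z)\<^sup>2, - 2 * Re z, 1:] x = (x - Re z)\<^sup>2 + (Im z)\<^sup>2"
      unfolding cmod_power2 by (simp add: power2_eq_square algebra_simps)
    ultimately show False using zero_le_power2[of "x - Re z"] zero_le_power2[of "Im z"] by linarith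
  qed
  define a where "a = Re z"
  have za: "z = of_real a" using Im by (simp add: a_def complex_eq_iff)
  have "poly p a = 0" using z unfolding za by (simp add: poly_map_poly_of_real)
  then obtain q where q: "p = [:- a, 1:] * q" by (auto simp: poly_eq_0_iff_dvd)
  have "q \<noteq> 0" using Suc.prems(1) q by auto
  then have dq: "degree p = Suc (degree q)" unfolding q by (subst degree_mult_eq) auto
  have "card {x. poly q x = 0} = degree q"
  proof (rule Suc.hyps(1))
    show "n = degree q" using dq Suc.hyps(2) by simp
    show "\<exists>x. poly d x < 0" if "d dvd q" "degree d = 2" for d
      using Suc.prems(2)[of d] that q by (metis dvd_mult)
  qed fact
  moreover have "poly q a \<noteq> 0"
  proof
    assume "poly q a = 0"
    then have "[:- a, 1:] * [:- a, 1:] dvd p"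
      unfolding q by (intro mult_dvd_mono) (auto simp: poly_eq_0_iff_dvd)
    from Suc.prems(2)[OF this] obtain x where "poly ([:- a, 1:] * [:- a, 1:]) x < 0"
      by (auto simp: degree_mult_eq)
    moreover have "poly ([:- a, 1:] * [:- a, 1:]) x = (x - a) * (x - a)" unfolding poly_mult by simp
    ultimately show False using zero_le_square[of "x - a"] by linarith
  qed
  moreover have "{x. poly p x = 0} = insert a {x. poly q x = 0}" by (auto simp: q)
  ultimately show ?case using dq poly_roots_finite[OF \<open>q \<noteq> 0\<close>] by simp
qed

section \<open>Orthogonal polynomials of a positive functional\<close>

lemma degree_less_if_coeff_0:
  "p \<noteq> 0 \<Longrightarrow> degree p \<le> n \<Longrightarrow> coeff p n = 0 \<Longrightarrow> degree p < n"
  using leading_coeff_0_iff[of p] by (cases "degree p = n") auto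

text \<open>An integral seen only through its values on polynomials, so that the same results serve
  \<mu>1 and its product with an endpoint factor. Strictness in \<open>pos\<close> is what a measure
  on the interval with infinite support provides.\<close>

locale positive_functional =
  fixes I :: "real poly \<Rightarrow> real"
  assumes add: "I (p + q) = I p + I q"
    and smult: "I (smult c p) = c * I p"
    and pos: "p \<noteq> 0 \<Longrightarrow> (\<And>x. x \<in> {-1..1} \<Longrightarrow> 0 \<le> poly p x) \<Longrightarrow> 0 < I p"
begin

lemma zero [simp]: "I 0 = 0"
  using smult[of 0 0] by simp

lemma diff: "I (p - q) = I p - I q"
  using add[of "p - q" q] by simp

lemma sum: "I (\<Sum>x\<in>A. g x) = (\<Sum>x\<in>A. I (g x))"
  by (induction A rule: infinite_finite_induct) (simp_all add: add)

lemma nonneg: "(\<And>x. x \<in> {-1..1} \<Longrightarrow> 0 \<le> poly p x) \<Longrightarrow> 0 \<le> I p"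
  using pos[of p] by (cases "p = 0") (auto intro: less_imp_le)

lemma square_pos: "p \<noteq> 0 \<Longrightarrow> 0 < I (p * p)"
  by (rule pos) auto

text \<open>A Gram-Schmidt step: \<open>e\<close> is the monic orthogonal polynomial of degree
  \<open>n\<close>, and \<open>c\<close> removes the component of \<open>p\<close> along it.
  Vanishing coefficients replace the condition \<open>degree r < n\<close>, which nothing satisfies
  for n = 0.\<close>

lemma projection_exists:
  "\<exists>r. (\<forall>i\<ge>n. coeff r i = 0) \<and> (\<forall>q. (\<forall>i\<ge>n. coeff q i = 0) \<longrightarrow> I ((p - r) * q) = 0)"
proof (induction n arbitrary: p)
  case 0
  have "I ((p - 0) * q) = 0" if "\<forall>i\<ge>0. coeff q i = 0" for q
  proof -
    have "q = 0" using that by (intro poly_eqI) simp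
    then show ?thesis by simp
  qed
  then show ?case by (intro exI[of _ 0]) simp
next
  case (Suc n)
  obtain r where r: "\<And>i. i \<ge> n \<Longrightarrow> coeff r i = 0"
    "\<And>q. (\<forall>i\<ge>n. coeff q i = 0) \<Longrightarrow> I ((p - r) * q) = 0" using Suc[of p] by blast
  obtain s where s: "\<And>i. i \<ge> n \<Longrightarrow> coeff s i = 0"
    "\<And>q. (\<forall>i\<ge>n. coeff q i = 0) \<Longrightarrow> I ((monom 1 n - s) * q) = 0" using Suc[of "monom 1 n"] by blast
  define e where "e = monom 1 n - s"
  have e: "coeff e n = 1" "\<And>i. i > n \<Longrightarrow> coeff e i = 0" using s(1) by (auto simp: e_def)
  then have "e \<noteq> 0" by auto
  define c where "c = I ((p - r) * e) / I (e * e)"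
  have c: "I ((p - r - smult c e) * e) = 0"
    using square_pos[OF \<open>e \<noteq> 0\<close>] by (simp add: c_def left_diff_distrib diff smult divide_simps)
  have "I ((p - (r + smult c e)) * q) = 0" if q: "\<forall>i\<ge>Suc n. coeff q i = 0" for q
  proof -
    define q' where "q' = q - smult (coeff q n) e"
    have q': "\<forall>i\<ge>n. coeff q' i = 0"
    proof (intro allI impI)
      fix i assume "n \<le> i"
      then consider "i = n" | "i > n" by linarith
      then show "coeff q' i = 0" using q e by cases (simp_all add: q'_def)
    qed
    have "(p - (r + smult c e)) * q =
        smult (coeff q n) ((p - r - smult c e) * e) + ((p - r) * q' - smult c (e * q'))"
      by (simp add: q'_def algebra_simps smult_diff_right smult_add_right)
    then show ?thesis using c r(2)[OF q'] s(2)[OF q'] by (simp add: add diff smult e_def)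
  qed
  moreover have "\<forall>i\<ge>Suc n. coeff (r + smult c e) i = 0" using r(1) e(2) by simp
  ultimately show ?case by blast
qed

lemma monic_orthogonal_ex1:
  "\<exists>!p. degree p = n \<and> lead_coeff p = 1 \<and> (\<forall>q. degree q < n \<longrightarrow> I (p * q) = 0)"
proof (rule ex_ex1I)
  obtain r where r: "\<And>i. i \<ge> n \<Longrightarrow> coeff r i = 0"
    "\<And>q. (\<forall>i\<ge>n. coeff q i = 0) \<Longrightarrow> I ((monom 1 n - r) * q) = 0"
    using projection_exists[of n "monom 1 n"] by blast
  have "degree (monom 1 n - r) = n"
    using r(1) by (intro antisym degree_le le_degree) auto
  moreover have "coeff (monom 1 n - r) n = 1" using r(1) by simp
  moreover have "I ((monom 1 n - r) * q) = 0" if "degree q < n" for q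
    using that by (intro r(2)) (simp add: coeff_eq_0)
  ultimately show "\<exists>p. degree p = n \<and> lead_coeff p = 1 \<and> (\<forall>q. degree q < n \<longrightarrow> I (p * q) = 0)"
    by (intro exI[of _ "monom 1 n - r"]) simp
next
  fix p p' assume p: "degree p = n \<and> lead_coeff p = 1 \<and> (\<forall>q. degree q < n \<longrightarrow> I (p * q) = 0)"
    and p': "degree p' = n \<and> lead_coeff p' = 1 \<and> (\<forall>q. degree q < n \<longrightarrow> I (p' * q) = 0)"
  show "p = p'"
  proof (rule ccontr)
    assume "p \<noteq> p'"
    then have "p - p' \<noteq> 0" by simp
    moreover have "coeff (p - p') n = 0" using p p' by auto
    moreover have "degree (p - p') \<le> n" using p p' by (intro degree_diff_le) auto
    ultimately have "degree (p - p') < n"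
      using degree_less_if_coeff_0 by blast
    then have "I ((p - p') * (p - p')) = 0"
      using p p' by (simp add: left_diff_distrib diff)
    then show False using square_pos[OF \<open>p - p' \<noteq> 0\<close>] by simp
  qed
qed

text \<open>Testing \<open>P\<close> against its cofactor \<open>q\<close> integrates d q^2, which
  is nonzero and nonnegative on the interval.\<close>

lemma orthogonal_no_definite_factor:
  assumes orth: "\<And>q. degree q < degree P \<Longrightarrow> I (P * q) = 0" and "P = d * q" "P \<noteq> 0"
    and "0 < degree d" and d: "\<And>x. x \<in> {-1..1} \<Longrightarrow> 0 \<le> poly d x"
  shows False
proof -
  have "d \<noteq> 0" "q \<noteq> 0" using assms by auto
  then have "degree q < degree P" using assms by (simp add: degree_mult_eq)
  then have "I (d * (q * q)) = 0" using orth[of q] assms(2) by (simp add: mult.assoc)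
  moreover have "0 < I (d * (q * q))" using \<open>d \<noteq> 0\<close> \<open>q \<noteq> 0\<close> d by (intro pos) auto
  ultimately show False by simp
qed

lemma orthogonal_zeros:
  assumes orth: "\<And>q. degree q < degree P \<Longrightarrow> I (P * q) = 0" and "P \<noteq> 0"
  shows "card {x. poly P x = 0} = degree P" "{x. poly P x = 0} \<subseteq> {-1<..<1}"
proof -
  show "card {x. poly P x = 0} = degree P"
  proof (rule card_roots_eq_degree)
    fix d assume "d dvd P" "degree d = 2"
    then obtain q where "P = d * q" by blast
    then show "\<exists>x. poly d x < 0"
      using orthogonal_no_definite_factor[OF orth, of d q] \<open>P \<noteq> 0\<close> \<open>degree d = 2\<close>
      by (force simp: not_le)
  qed fact
  show "{x. poly P x = 0} \<subseteq> {-1<..<1}"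
  proof
    fix a assume "a \<in> {x. poly P x = 0}"
    then obtain q where q: "P = [:- a, 1:] * q" by (auto simp: poly_eq_0_iff_dvd)
    \<comment> \<open>The factor x - a is nonnegative on the interval for a \<le> -1, and a - x is
      for a \<ge> 1.\<close>
    have q': "P = [:a, -1:] * (- q)" unfolding q by simp
    show "a \<in> {-1<..<1}"
    proof (rule ccontr)
      assume "a \<notin> {-1<..<1}"
      then consider "a \<ge> 1" | "a \<le> -1" by force
      then show False
        using orthogonal_no_definite_factor[OF orth q \<open>P \<noteq> 0\<close>]
          orthogonal_no_definite_factor[OF orth q' \<open>P \<noteq> 0\<close>] by cases auto
    qed
  qed
qed

end

section \<open>Quadrature with prescribed endpoints\<close>

text \<open>The densities 1 - x^2, 1 - x and 1 + x of the three modified measures. The factor 1 - e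
  x, unlike x - e, is nonnegative on the interval for both endpoints.\<close>

definition endpoint_factor :: "real set \<Rightarrow> real poly" where
  "endpoint_factor E = (\<Prod>e\<in>E. [:1, - e:])"

lemma endpoint_factor_nonneg:
  "E \<subseteq> {1, -1} \<Longrightarrow> x \<in> {-1..1} \<Longrightarrow> 0 \<le> poly (endpoint_factor E) x"
  unfolding endpoint_factor_def poly_prod by (rule prod_nonneg) auto

lemma endpoint_factor_eq_0_iff:
  "E \<subseteq> {1, -1} \<Longrightarrow> poly (endpoint_factor E) x = 0 \<longleftrightarrow> x \<in> E"
  using finite_subset[of E "{1, -1}"] unfolding endpoint_factor_def poly_prod by (auto simp: prod_zero_iff)

lemma degree_endpoint_factor:
  assumes "E \<subseteq> {1, -1}"
  shows "degree (endpoint_factor E) = card E"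
proof -
  have "e \<noteq> 0" if "e \<in> E" for e using that assms by auto
  then have "(\<Sum>e\<in>E. degree [:1, - e:]) = (\<Sum>e\<in>E. 1)" by (intro sum.cong) auto
  then show ?thesis unfolding endpoint_factor_def by (subst degree_prod_sum_eq) auto
qed

lemma endpoint_factor_nonzero: "E \<subseteq> {1, -1} \<Longrightarrow> endpoint_factor E \<noteq> 0"
  using endpoint_factor_eq_0_iff[of E 0] by auto

lemma (in positive_functional) positive_functional_endpoint:
  assumes "E \<subseteq> {1, -1}"
  shows "positive_functional (\<lambda>p. I (endpoint_factor E * p))"
proof
  show "0 < I (endpoint_factor E * p)" if "p \<noteq> 0" "\<And>x. x \<in> {-1..1} \<Longrightarrow> 0 \<le> poly p x" for p
    using that assms endpoint_factor_nonneg endpoint_factor_nonzero by (intro pos) auto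
qed (simp_all add: ring_distribs add smult)

text \<open>Here \<open>P\<close> is orthogonal for the measure modified by the endpoint factor, but
  the quadrature is for \<open>I\<close> itself. The choice of \<open>E\<close> distinguishes the
  three nodal systems.\<close>

locale endpoint_quadrature = positive_functional +
  fixes E :: "real set" and P :: "real poly"
  assumes E: "E \<subseteq> {1, -1}" "E \<noteq> {}"
    and monic: "lead_coeff P = 1"
    and orth: "degree q < degree P \<Longrightarrow> I (endpoint_factor E * P * q) = 0"
begin

definition "X = {x. poly P x = 0} \<union> E"
definition "lbasis y = (SOME p. degree p < card X \<and> (\<forall>x\<in>X. poly p x = (if x = y then 1 else 0)))"
definition "weight y = I (lbasis y)"

sublocale E: positive_functional "\<lambda>p. I (endpoint_factor E * p)"
  by (rule positive_functional_endpoint[OF E(1)])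

lemma P_nz [simp]: "P \<noteq> 0" using monic by auto

lemma zeros: "card {x. poly P x = 0} = degree P" "{x. poly P x = 0} \<subseteq> {-1<..<1}"
  using E.orthogonal_zeros[of P] orth by (simp_all add: mult.assoc)

lemma P_endpoint: "e \<in> E \<Longrightarrow> poly P e \<noteq> 0"
  using zeros(2) E(1) by (metis (mono_tags, lifting) greaterThanLessThan_iff insertE less_irrefl
    mem_Collect_eq singletonD subsetD)

lemma finite_E: "finite E" using E(1) finite_subset by blast

lemma finite_X: "finite X"
  using poly_roots_finite[of P] finite_E by (auto simp: X_def)

lemma X_subset: "X \<subseteq> {-1..1}"
  using zeros(2) E(1) by (auto simp: X_def subset_iff less_imp_le)

lemma card_X: "card X = degree P + card E"
proof -
  have "{x. poly P x = 0} \<inter> E = {}" using P_endpoint by auto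
  then show ?thesis using zeros(1) finite_E poly_roots_finite[of P] by (simp add: X_def card_Un_disjoint)
qed

lemma card_X_pos: "0 < card X" using E(2) finite_E by (simp add: card_X card_gt_0_iff)

lemma X_nonempty: "X \<noteq> {}" using E(2) by (simp add: X_def)

lemma lbasis: "degree (lbasis y) < card X" "x \<in> X \<Longrightarrow> poly (lbasis y) x = (if x = y then 1 else 0)"
proof -
  have "degree (lbasis y) < card X \<and> (\<forall>x\<in>X. poly (lbasis y) x = (if x = y then 1 else 0))"
    unfolding lbasis_def by (rule someI_ex[OF interpolating_poly_exists[OF finite_X X_nonempty]])
  then show "degree (lbasis y) < card X" "x \<in> X \<Longrightarrow> poly (lbasis y) x = (if x = y then 1 else 0)" by auto
qed

lemma lagrange_expansion:
  assumes "degree r < card X"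
  shows "r = (\<Sum>x\<in>X. smult (poly r x) (lbasis x))"
proof (rule poly_eqI_degree[of X])
  show "poly r y = poly (\<Sum>x\<in>X. smult (poly r x) (lbasis x)) y" if "y \<in> X" for y
    using that finite_X by (simp add: poly_sum lbasis(2) if_distrib cong: if_cong)
  show "card X > degree (\<Sum>x\<in>X. smult (poly r x) (lbasis x))"
    using lbasis(1) card_X_pos
    by (intro degree_sum_less) (auto intro: le_less_trans[OF degree_smult_le])
qed (use assms in auto)

text \<open>Division by the nodal polynomial \<open>W\<close> of degree \<open>card X\<close> leaves
  a quotient of degree below \<open>degree P\<close>, which \<open>orth\<close> annihilates, and a
  remainder that has the values of \<open>q\<close> at the nodes and is integrated by Lagrange's
  formula.\<close>

lemma quadrature_exact:
  assumes "degree q < card X + degree P"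
  shows "I q = (\<Sum>x\<in>X. weight x * poly q x)"
proof -
  define W where "W = endpoint_factor E * P"
  have W: "W \<noteq> 0" "\<And>x. x \<in> X \<Longrightarrow> poly W x = 0"
    using E(1) endpoint_factor_nonzero[OF E(1)] degree_endpoint_factor[OF E(1)] endpoint_factor_eq_0_iff[OF E(1)]
    by (auto simp: W_def X_def)
  have dW: "degree W = card X"
    using endpoint_factor_nonzero[OF E(1)] degree_endpoint_factor[OF E(1)]
    by (simp add: W_def degree_mult_eq card_X)
  let ?s = "q div W" and ?r = "q mod W"
  have r: "degree ?r < card X"
    using degree_mod_less'[of W q] W dW card_X_pos by (cases "?r = 0") auto
  have "I (W * ?s) = 0"
  \<comment> \<open>The quotient 0 is treated apart: if \<open>degree P = 0\<close>, its degree is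
    not below \<open>degree P\<close> and \<open>orth\<close> does not apply.\<close>
  proof (cases "?s = 0")
    case False
    then have "degree (W * ?s) = card X + degree ?s" using W dW by (simp add: degree_mult_eq)
    moreover from this r have "degree (W * ?s + ?r) = degree (W * ?s)"
      by (intro degree_add_eq_left) simp
    ultimately have "degree q = card X + degree ?s" by simp
    then show ?thesis using assms orth unfolding W_def by simp
  qed simp
  moreover have "I q = I (W * ?s) + I ?r" by (simp flip: add)
  ultimately have "I q = I ?r" by simp
  also have "\<dots> = (\<Sum>x\<in>X. weight x * poly ?r x)"
    by (subst lagrange_expansion[OF r]) (simp add: sum smult weight_def mult.commute)
  also have "\<dots> = (\<Sum>x\<in>X. weight x * poly q x)"
  proof (rule sum.cong)
    fix x assume "x \<in> X"
    then have "poly (W * ?s + ?r) x = poly ?r x"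
      using W(2) by (simp only: poly_add poly_mult mult_zero_left add_0_left)
    then show "weight x * poly ?r x = weight x * poly q x" by (simp only: mult_div_mod_eq)
  qed simp
  finally show ?thesis .
qed

lemma weight_nonneg_witness:
  assumes "y \<in> X" "degree u < card X + degree P" "\<And>x. x \<in> {-1..1} \<Longrightarrow> 0 \<le> poly u x"
    and "\<And>x. x \<in> X \<Longrightarrow> x \<noteq> y \<Longrightarrow> poly u x = 0" "poly u y \<noteq> 0"
  shows "0 \<le> weight y"
proof -
  have "0 \<le> I u" using assms(3) by (rule nonneg)
  also have "I u = (\<Sum>x\<in>X. if x = y then weight y * poly u y else 0)"
    unfolding quadrature_exact[OF assms(2)] using assms(4) by (intro sum.cong) auto
  also have "\<dots> = weight y * poly u y" using assms(1) finite_X by simp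
  finally show ?thesis using assms(3)[of y] assms(1,5) X_subset
    by (auto simp: zero_le_mult_iff)
qed

text \<open>At an endpoint the witness is P^2 times the factor of the other endpoint, if there is
  one; it has the largest degree of exactness. At a zero y of \<open>P\<close> the witness is the
  endpoint factor times (P / (x - y))^2, which is nonzero at y because the zeros of \<open>P\<close>
  are simple.\<close>

lemma weight_nonneg:
  assumes "y \<in> X"
  shows "0 \<le> weight y"
proof (cases "y \<in> E")
  case True
  have E': "E - {y} \<subseteq> {1, -1}" using E by auto
  let ?u = "endpoint_factor (E - {y}) * (P * P)"
  have "card E > 0" using True finite_E card_gt_0_iff by blast
  then have "degree ?u < card X + degree P"
    using True finite_E endpoint_factor_nonzero[OF E'] degree_endpoint_factor[OF E']
    by (simp add: degree_mult_eq card_X)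
  moreover have "poly ?u y \<noteq> 0" using endpoint_factor_eq_0_iff[OF E'] P_endpoint[OF True] by auto
  moreover have "poly ?u x = 0" if "x \<in> X" "x \<noteq> y" for x
    using that endpoint_factor_eq_0_iff[OF E'] by (auto simp: X_def)
  ultimately show ?thesis
    using endpoint_factor_nonneg[OF E'] by (intro weight_nonneg_witness[OF assms, of ?u]) auto
next
  case False
  then have "poly P y = 0" using assms by (simp add: X_def)
  then obtain q where q: "P = [:- y, 1:] * q" by (auto simp: poly_eq_0_iff_dvd)
  have "q \<noteq> 0" using P_nz q by auto
  then have dq: "degree P = Suc (degree q)" unfolding q by (subst degree_mult_eq) auto
  have "poly q y \<noteq> 0"
  proof
    assume "poly q y = 0"
    then have "{x. poly P x = 0} = {x. poly q x = 0}" by (auto simp: q)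
    then have "degree P \<le> degree q" using zeros(1) card_poly_roots_bound[OF \<open>q \<noteq> 0\<close>] by simp
    then show False using dq by simp
  qed
  have Pq: "poly P x = (x - y) * poly q x" for x unfolding q by (simp add: algebra_simps)
  show ?thesis
  proof (rule weight_nonneg_witness[OF assms])
    show "degree (endpoint_factor E * (q * q)) < card X + degree P"
      using dq \<open>q \<noteq> 0\<close> endpoint_factor_nonzero[OF E(1)] degree_endpoint_factor[OF E(1)]
      by (simp add: degree_mult_eq card_X)
    show "poly (endpoint_factor E * (q * q)) y \<noteq> 0"
      using endpoint_factor_eq_0_iff[OF E(1)] False \<open>poly q y \<noteq> 0\<close> by simp
    show "0 \<le> poly (endpoint_factor E * (q * q)) x" if "x \<in> {-1..1}" for x
      using endpoint_factor_nonneg[OF E(1) that] by simp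
    show "poly (endpoint_factor E * (q * q)) x = 0" if "x \<in> X" "x \<noteq> y" for x
    proof (cases "x \<in> E")
      case False
      then have "poly P x = 0" using that by (simp add: X_def)
      then show ?thesis using that Pq[of x] by simp
    qed (use endpoint_factor_eq_0_iff[OF E(1)] in simp)
  qed
qed

lemma weight_le:
  assumes "y \<in> X" "degree q \<le> degree P" "poly q y = 1"
  shows "weight y \<le> I (q * q)"
proof -
  have "degree (q * q) < card X + degree P"
    using degree_mult_le[of q q] assms(2) E(2) finite_E card_gt_0_iff[of E] card_X by linarith
  then have "I (q * q) = (\<Sum>x\<in>X. weight x * poly (q * q) x)" by (rule quadrature_exact)
  also have "\<dots> \<ge> weight y * poly (q * q) y"
    using assms(1) finite_X weight_nonneg by (intro member_le_sum) auto
  finally show ?thesis using assms(3) by simp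
qed

text \<open>For two endpoints the quadrature fails by one degree; the defect of \<open>p * p\<close> has a sign,
  as it is a multiple of the polynomial \<open>(x\<^sup>2 - 1) * P * P\<close>, which vanishes on \<open>X\<close>.\<close>

lemma square_le_quadrature:
  assumes "degree p < card X"
  shows "I (p * p) \<le> (\<Sum>x\<in>X. weight x * (poly p x)\<^sup>2)"
proof (cases "degree (p * p) < card X + degree P")
  case True
  then show ?thesis by (simp add: quadrature_exact power2_eq_square)
next
  case False
  have "card E \<le> 2" using card_mono[OF _ E(1)] by simp
  moreover have "card E > 0" using E(2) finite_E by (simp add: card_gt_0_iff)
  moreover have "p \<noteq> 0" using False card_X_pos by auto
  ultimately have cE: "card E = 2" and dp: "degree p = Suc (degree P)"
    using assms False by (auto simp: degree_mult_eq card_X)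
  then have E2: "E = {1, -1}" using card_subset_eq[OF _ E(1)] by simp
  define a where "a = lead_coeff p"
  define Q where "Q = endpoint_factor E * (P * P)"
  have dQ: "degree Q = 2 + 2 * degree P"
    using cE endpoint_factor_nonzero[OF E(1)] degree_endpoint_factor[OF E(1)]
    by (simp add: Q_def degree_mult_eq)
  have "lead_coeff Q = - 1"
    unfolding Q_def lead_coeff_mult E2 endpoint_factor_def using monic by simp
  then have lQ: "coeff Q (2 + 2 * degree P) = -1" using dQ by simp
  define R where "R = p * p + smult (a\<^sup>2) Q"
  have dpp: "degree (p * p) = 2 + 2 * degree P" using dp \<open>p \<noteq> 0\<close> by (simp add: degree_mult_eq)
  have "coeff (p * p) (2 + 2 * degree P) = a\<^sup>2"
    using lead_coeff_mult[of p p] unfolding dpp a_def power2_eq_square .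
  then have "coeff R (2 + 2 * degree P) = 0" using lQ by (simp add: R_def)
  moreover have "degree R \<le> 2 + 2 * degree P"
    unfolding R_def using dQ dpp by (intro degree_add_le) (auto intro: order.trans[OF degree_smult_le])
  ultimately have "degree R < 2 + 2 * degree P"
    using degree_less_if_coeff_0[of R "2 + 2 * degree P"] by (cases "R = 0") auto
  then have "I R = (\<Sum>x\<in>X. weight x * poly R x)" using cE by (intro quadrature_exact) (simp add: card_X)
  also have "\<dots> = (\<Sum>x\<in>X. weight x * (poly p x)\<^sup>2)"
    using endpoint_factor_eq_0_iff[OF E(1)] by (intro sum.cong) (auto simp: R_def Q_def X_def power2_eq_square)
  finally have "(\<Sum>x\<in>X. weight x * (poly p x)\<^sup>2) = I (p * p) + a\<^sup>2 * I Q" by (simp add: R_def add smult)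
  moreover have "0 \<le> I Q" using endpoint_factor_nonneg[OF E(1)] by (intro nonneg) (auto simp: Q_def)
  ultimately show ?thesis by simp
qed

text \<open>\<open>sup\<close> bounds the Christoffel-Darboux kernel and \<open>peak\<close> bounds
  the weights. Their dependence on the degree cancels, so the constant does not depend on the number
  of nodes.\<close>

lemma square_le_sum_nodes:
  assumes sup: "\<And>m p x. degree p \<le> m \<Longrightarrow> x \<in> {-1..1} \<Longrightarrow> (poly p x)\<^sup>2 \<le> A * real (m + 1) * I (p * p)"
    and peak: "\<And>m y. y \<in> {-1..1} \<Longrightarrow> \<exists>q. degree q \<le> m \<and> poly q y = 1 \<and> I (q * q) \<le> B / real (m + 1)"
    and "0 \<le> A" "0 \<le> B" "degree p < card X" "x \<in> {-1..1}"
  shows "(poly p x)\<^sup>2 \<le> 2 * A * B * (\<Sum>y\<in>X. (poly p y)\<^sup>2)"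
proof -
  let ?n = "degree P"
  have "card E \<le> 2" using card_mono[OF _ E(1)] by simp
  then have cX: "card X \<le> ?n + 2" by (simp add: card_X)
  have w: "weight y \<le> B / real (?n + 1)" if y: "y \<in> X" for y
    using peak[of y ?n] weight_le[OF y] X_subset y by fastforce
  have "(poly p x)\<^sup>2 \<le> A * real (?n + 1 + 1) * I (p * p)"
    using assms cX by (intro sup) auto
  also have "\<dots> \<le> A * real (?n + 1 + 1) * (\<Sum>y\<in>X. weight y * (poly p y)\<^sup>2)"
    using \<open>0 \<le> A\<close> by (intro mult_left_mono square_le_quadrature assms) auto
  also have "\<dots> \<le> A * real (?n + 1 + 1) * (\<Sum>y\<in>X. B / real (?n + 1) * (poly p y)\<^sup>2)"
    using \<open>0 \<le> A\<close> w by (intro mult_left_mono sum_mono mult_right_mono) auto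
  also have "\<dots> = (real (?n + 2) / real (?n + 1)) * (A * B * (\<Sum>y\<in>X. (poly p y)\<^sup>2))"
    unfolding sum_distrib_left[symmetric] by simp
  \<comment> \<open>The 2 bounds (n + 2) / (n + 1): \<open>sup\<close> is applied in degree n + 1,
    whereas exactness restricts \<open>peak\<close> to degree n.\<close>
  also have "\<dots> \<le> 2 * (A * B * (\<Sum>y\<in>X. (poly p y)\<^sup>2))"
    using assms(3,4) by (intro mult_right_mono) (auto simp: field_simps sum_nonneg)
  finally show ?thesis by simp
qed

end

section \<open>Comparison with the Chebyshev weight\<close>

fun cheb :: "nat \<Rightarrow> real poly" where
  "cheb 0 = 1"
| "cheb (Suc 0) = [:0, 1:]"
| "cheb (Suc (Suc n)) = [:0, 2:] * cheb (Suc n) - cheb n"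

lemma poly_cheb_cos: "poly (cheb n) (cos t) = cos (real n * t)"
proof (induction n rule: cheb.induct)
  case (3 n)
  have "cos (real (Suc n) * t + t) + cos (real (Suc n) * t - t) = 2 * cos t * cos (real (Suc n) * t)"
    by (simp add: cos_add cos_diff)
  moreover have "real (Suc (Suc n)) * t = real (Suc n) * t + t" "real n * t = real (Suc n) * t - t"
    by (simp_all add: algebra_simps)
  ultimately show ?case using 3 by simp
qed simp_all

lemma degree_coeff_cheb: "degree (cheb n) = n \<and> 0 < coeff (cheb n) n"
proof (induction n rule: cheb.induct)
  case (3 n)
  have "coeff (cheb (Suc (Suc n))) (Suc (Suc n)) = 2 * coeff (cheb (Suc n)) (Suc n)"
    using 3 by (simp add: coeff_eq_0)
  moreover have "degree (cheb (Suc (Suc n))) \<le> Suc (Suc n)"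
    using 3 degree_mult_le[of "[:0, 2:]" "cheb (Suc n)"] unfolding cheb.simps
    by (intro degree_diff_le) auto
  moreover have "0 < 2 * coeff (cheb (Suc n)) (Suc n)" using 3 by simp
  ultimately show ?case by (metis le_antisym le_degree less_irrefl)
qed simp_all

lemma cheb_expansion:
  "degree p \<le> m \<Longrightarrow> \<exists>c. p = (\<Sum>j\<le>m. smult (c j) (cheb j))"
proof (induction m arbitrary: p)
  case 0
  then show ?case by (intro exI[of _ "coeff p"]) (auto elim!: degree_eq_zeroE)
next
  case (Suc m)
  define a where "a = coeff p (Suc m) / coeff (cheb (Suc m)) (Suc m)"
  define q where "q = p - smult a (cheb (Suc m))"
  have "degree q \<le> m"
  proof (rule degree_le, intro allI impI)
    fix i assume "m < i"
    then consider "i = Suc m" | "i > Suc m" by linarith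
    then show "coeff q i = 0"
      using degree_coeff_cheb[of "Suc m"] Suc.prems
      by cases (auto simp: q_def a_def coeff_eq_0 simp del: cheb.simps)
  qed
  then obtain c where "q = (\<Sum>j\<le>m. smult (c j) (cheb j))" using Suc.IH by blast
  then have "p = (\<Sum>j\<le>Suc m. smult ((c(Suc m := a)) j) (cheb j))"
    by (simp add: q_def algebra_simps del: cheb.simps)
  then show ?case by blast
qed

lemma poly_cheb_arccos: "x \<in> {-1..1} \<Longrightarrow> poly (cheb n) x = cos (real n * arccos x)"
  using poly_cheb_cos[of n "arccos x"] by simp

lemma abs_poly_cheb_le_1: "x \<in> {-1..1} \<Longrightarrow> \<bar>poly (cheb n) x\<bar> \<le> 1"
  by (simp add: poly_cheb_arccos)

lemma poly_cheb_mult: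
  assumes "x \<in> {-1..1}"
  shows "poly (cheb j) x * poly (cheb k) x =
    (poly (cheb (j + k)) x + poly (cheb (if j \<le> k then k - j else j - k)) x) / 2"
proof -
  let ?t = "arccos x"
  have "cos (real (if j \<le> k then k - j else j - k) * ?t) = cos (real j * ?t - real k * ?t)"
    using cos_minus[of "real j * ?t - real k * ?t"]
    by (auto simp: of_nat_diff algebra_simps)
  then show ?thesis using assms
    by (simp add: poly_cheb_arccos cos_add cos_diff ring_distribs)
qed

section \<open>Integration against the Chebyshev weight\<close>

abbreviation Icc_measure :: "real measure" where
  "Icc_measure \<equiv> restrict_space lborel {-1..1}"

definition cheb_integral :: "real poly \<Rightarrow> real" where
  "cheb_integral p = (\<integral>x. poly p x * (1 / sqrt (1 - x\<^sup>2)) \<partial>Icc_measure)"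

lemma borel_measurable_poly [measurable]: "poly p \<in> borel_measurable borel" for p :: "real poly"
  by (intro borel_measurable_continuous_onI continuous_intros)

lemma poly_bounded_Icc: "\<exists>B. \<forall>x\<in>{-1..1}. \<bar>poly p x\<bar> \<le> B" for p :: "real poly"
proof -
  have "compact (poly p ` {-1..1})" by (intro compact_continuous_image continuous_intros compact_Icc)
  then show ?thesis using compact_imp_bounded[of "poly p ` {-1..1}"] by (auto simp: bounded_iff)
qed

lemma one_minus_sq_pos: "-1 < x \<Longrightarrow> x < 1 \<Longrightarrow> 0 < 1 - x\<^sup>2" for x :: real
  using abs_square_less_1[of x] by simp

lemma arccos_tendsto_endpoints:
  "(arccos \<longlongrightarrow> arccos (-1)) (at_right (-1))" "(arccos \<longlongrightarrow> arccos 1) (at_left 1)"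
proof -
  have "(arccos \<longlongrightarrow> arccos a) (at a within {-1..1})" if "a \<in> {-1..1}" for a
    using continuous_on_arccos' that unfolding continuous_on_def by blast
  from this[of "-1"] this[of 1]
  show "(arccos \<longlongrightarrow> arccos (-1)) (at_right (-1))" "(arccos \<longlongrightarrow> arccos 1) (at_left 1)"
    by (simp_all add: at_within_Icc_at_left at_within_Icc_at_right)
qed

text \<open>The integrands to which this is applied are 0 at 1 and -1, since
  \<open>sqrt 0 = 0\<close> and division by 0 gives 0. The integral then lives on the open interval,
  where the fundamental theorem needs only limits of the antiderivative at the ends.\<close>

lemma Icc_integral_eq_interval_integral:
  fixes f :: "real \<Rightarrow> real"
  assumes "f 1 = 0" "f (-1) = 0"
  shows "(\<integral>x. f x \<partial>Icc_measure) = (LBINT x=ereal (-1)..ereal 1. f x)"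
    and "integrable Icc_measure f \<longleftrightarrow> set_integrable lborel {-1<..<1} f"
proof -
  have "(\<lambda>x. indicator {-1..1} x *\<^sub>R f x) = (\<lambda>x. indicator {-1<..<1} x *\<^sub>R f x)"
    using assms by (auto simp: fun_eq_iff less_le indicator_def)
  then show "(\<integral>x. f x \<partial>Icc_measure) = (LBINT x=ereal (-1)..ereal 1. f x)"
    "integrable Icc_measure f \<longleftrightarrow> set_integrable lborel {-1<..<1} f"
    by (simp_all add: integral_restrict_space integrable_restrict_space set_integrable_def
      interval_lebesgue_integral_def set_lebesgue_integral_def)
qed

lemma cheb_weight_integral:
  "integrable Icc_measure (\<lambda>x. 1 / sqrt (1 - x\<^sup>2))" "cheb_integral 1 = pi"
proof -
  let ?f = "\<lambda>x::real. 1 / sqrt (1 - x\<^sup>2)"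
  have "DERIV (\<lambda>x. - arccos x) x :> ?f x" if "ereal (-1) < ereal x" "ereal x < ereal 1" for x
    using that by (auto intro!: derivative_eq_intros simp: inverse_eq_divide)
  moreover have "isCont ?f x" if "ereal (-1) < ereal x" "ereal x < ereal 1" for x
    using that one_minus_sq_pos[of x] by (intro continuous_intros) auto
  moreover have "AE x in lborel. ereal (-1) < ereal x \<longrightarrow> ereal x < ereal 1 \<longrightarrow> 0 \<le> ?f x"
    by (intro AE_I2) (use one_minus_sq_pos in \<open>auto intro: less_imp_le\<close>)
  moreover have "(((\<lambda>x. - arccos x) \<circ> real_of_ereal) \<longlongrightarrow> - arccos (-1)) (at_right (ereal (-1)))"
    "(((\<lambda>x. - arccos x) \<circ> real_of_ereal) \<longlongrightarrow> - arccos 1) (at_left (ereal 1))"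
    unfolding ereal_tendsto_simps1 by (intro tendsto_minus arccos_tendsto_endpoints)+
  ultimately have "set_integrable lborel (einterval (ereal (-1)) (ereal 1)) ?f"
    "(LBINT x=ereal (-1)..ereal 1. ?f x) = - arccos 1 - (- arccos (-1))"
    by (intro interval_integral_FTC_nonneg[where F = "\<lambda>x. - arccos x"]; simp)+
  then show "integrable Icc_measure ?f" "cheb_integral 1 = pi"
    by (simp_all add: cheb_integral_def Icc_integral_eq_interval_integral)
qed

lemma integrable_poly_cheb_weight:
  "integrable Icc_measure (\<lambda>x. poly p x * (1 / sqrt (1 - x\<^sup>2)))"
proof -
  obtain B where B: "\<And>x. x \<in> {-1..1} \<Longrightarrow> \<bar>poly p x\<bar> \<le> B" using poly_bounded_Icc by blast
  show ?thesis
  proof (rule Bochner_Integration.integrable_bound)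
    show "integrable Icc_measure (\<lambda>x. B * (1 / sqrt (1 - x\<^sup>2)))"
      using cheb_weight_integral(1) by (rule integrable_mult_right)
    show "(\<lambda>x. poly p x * (1 / sqrt (1 - x\<^sup>2))) \<in> borel_measurable Icc_measure"
      by (intro measurable_restrict_space1) measurable
    show "AE x in Icc_measure. norm (poly p x * (1 / sqrt (1 - x\<^sup>2))) \<le> norm (B * (1 / sqrt (1 - x\<^sup>2)))"
    proof (rule AE_I2)
      fix x :: real assume "x \<in> space Icc_measure"
      then have "\<bar>poly p x\<bar> \<le> \<bar>B\<bar>" using B[of x] by (force simp: space_restrict_space)
      then show "norm (poly p x * (1 / sqrt (1 - x\<^sup>2))) \<le> norm (B * (1 / sqrt (1 - x\<^sup>2)))"
        unfolding real_norm_def abs_mult by (rule mult_right_mono) simp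
    qed
  qed
qed

lemma cheb_integral_add: "cheb_integral (p + q) = cheb_integral p + cheb_integral q"
  unfolding cheb_integral_def poly_add distrib_right
  by (rule Bochner_Integration.integral_add[OF integrable_poly_cheb_weight integrable_poly_cheb_weight])

lemma cheb_integral_smult: "cheb_integral (smult c p) = c * cheb_integral p"
  unfolding cheb_integral_def poly_smult mult.assoc
  by (rule Bochner_Integration.integral_mult_right_zero)

lemma cheb_integral_0: "cheb_integral 0 = 0"
  by (simp add: cheb_integral_def)

lemma cheb_integral_sum: "cheb_integral (\<Sum>x\<in>A. g x) = (\<Sum>x\<in>A. cheb_integral (g x))"
  by (induction A rule: infinite_finite_induct) (simp_all add: cheb_integral_add cheb_integral_0)

text \<open>For k > 0 an antiderivative is - sin (k arccos x) / k, and the sine vanishes at both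
  ends, where arccos is pi and 0.\<close>

lemma cheb_integral_cheb: "cheb_integral (cheb k) = (if k = 0 then pi else 0)"
proof (cases "k = 0")
  case False
  let ?F = "\<lambda>x. - (sin (real k * arccos x) / real k)"
  let ?f = "\<lambda>x. poly (cheb k) x * (1 / sqrt (1 - x\<^sup>2))"
  have lim: "((?F \<circ> real_of_ereal) \<longlongrightarrow> - (sin (real k * arccos (-1)) / real k)) (at_right (ereal (-1)))"
    "((?F \<circ> real_of_ereal) \<longlongrightarrow> - (sin (real k * arccos 1) / real k)) (at_left (ereal 1))"
    unfolding ereal_tendsto_simps1 using False
    by (intro tendsto_intros arccos_tendsto_endpoints; simp)+
  have "(LBINT x=ereal (-1)..ereal 1. ?f x) =
    - (sin (real k * arccos 1) / real k) - - (sin (real k * arccos (-1)) / real k)"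
  proof (rule interval_integral_FTC_integrable[where F = ?F, OF _ _ _ _ lim])
    fix x :: real assume "ereal (-1) < ereal x" "ereal x < ereal 1"
    then have x: "-1 < x" "x < 1" by auto
    have "DERIV ?F x :> ?f x"
      using x False
      by (auto intro!: derivative_eq_intros simp: poly_cheb_arccos field_simps)
    then show "(?F has_vector_derivative ?f x) (at x)"
      by (simp add: has_real_derivative_iff_has_vector_derivative)
    show "isCont ?f x" using one_minus_sq_pos[OF x] by (intro continuous_intros) auto
  next
    show "set_integrable lborel (einterval (ereal (-1)) (ereal 1)) ?f"
      using integrable_poly_cheb_weight[of "cheb k"]
      by (simp add: Icc_integral_eq_interval_integral)
  qed simp
  then show ?thesis using False
    by (simp add: cheb_integral_def Icc_integral_eq_interval_integral)
qed (use cheb_weight_integral(2) in simp)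

lemma cheb_orthogonality:
  "cheb_integral (cheb j * cheb k) = (if j = k then if j = 0 then pi else pi / 2 else 0)"
proof -
  have "cheb_integral (cheb j * cheb k) =
      cheb_integral (smult (1/2) (cheb (j + k) + cheb (if j \<le> k then k - j else j - k)))"
    unfolding cheb_integral_def
  proof (rule Bochner_Integration.integral_cong[OF refl])
    fix x assume "x \<in> space Icc_measure"
    then have "x \<in> {-1..1}" by (simp add: space_restrict_space)
    from poly_cheb_mult[OF this, of j k]
    have "poly (cheb j * cheb k) x = poly (smult (1/2) (cheb (j + k) + cheb (if j \<le> k then k - j else j - k))) x"
      by simp
    then show "poly (cheb j * cheb k) x * (1 / sqrt (1 - x\<^sup>2)) =
      poly (smult (1/2) (cheb (j + k) + cheb (if j \<le> k then k - j else j - k))) x * (1 / sqrt (1 - x\<^sup>2))"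
      by (simp only:)
  qed
  then show ?thesis
    by (simp only: cheb_integral_smult cheb_integral_add cheb_integral_cheb) auto
qed

lemma cheb_integral_square:
  "cheb_integral ((\<Sum>j\<le>m. smult (c j) (cheb j)) * (\<Sum>j\<le>m. smult (c j) (cheb j))) =
     (\<Sum>j\<le>m. (c j)\<^sup>2 * (if j = 0 then pi else pi / 2))"
proof -
  have "cheb_integral ((\<Sum>j\<le>m. smult (c j) (cheb j)) * (\<Sum>j\<le>m. smult (c j) (cheb j))) =
     (\<Sum>j\<le>m. \<Sum>k\<le>m. c j * (c k * cheb_integral (cheb j * cheb k)))"
    unfolding sum_product cheb_integral_sum
    by (intro sum.cong refl) (simp add: cheb_integral_smult mult.left_commute)
  also have "\<dots> = (\<Sum>j\<le>m. \<Sum>k\<le>m. if k = j then (c j)\<^sup>2 * (if j = 0 then pi else pi / 2) else 0)"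
    by (intro sum.cong) (auto simp: cheb_orthogonality power2_eq_square)
  finally show ?thesis by simp
qed

text \<open>Cauchy-Schwarz in the Chebyshev coefficients: each \<open>cheb j\<close> is at most 1 in
  modulus, whence m + 1, and its squared norm is at least pi / 2, whence 2 / pi.\<close>

lemma square_le_cheb_integral:
  assumes "degree p \<le> m" "x \<in> {-1..1}"
  shows "(poly p x)\<^sup>2 \<le> 2 / pi * real (m + 1) * cheb_integral (p * p)"
proof -
  obtain c where c: "p = (\<Sum>j\<le>m. smult (c j) (cheb j))" using cheb_expansion[OF assms(1)] by blast
  have sq: "cheb_integral (p * p) = (\<Sum>j\<le>m. (c j)\<^sup>2 * (if j = 0 then pi else pi / 2))"
    unfolding c by (rule cheb_integral_square)
  have "(poly p x)\<^sup>2 = (\<Sum>j\<le>m. c j * poly (cheb j) x)\<^sup>2" by (simp add: c poly_sum)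
  also have "\<dots> \<le> (\<Sum>j\<le>m. (c j)\<^sup>2) * (\<Sum>j\<le>m. (poly (cheb j) x)\<^sup>2)"
    by (rule Cauchy_Schwarz_ineq_sum)
  also have "\<dots> \<le> (2 / pi * cheb_integral (p * p)) * (\<Sum>j\<le>m. 1)"
  proof (rule mult_mono)
    show "(\<Sum>j\<le>m. (poly (cheb j) x)\<^sup>2) \<le> (\<Sum>j\<le>m. 1)"
      using abs_poly_cheb_le_1[OF assms(2)] by (intro sum_mono) (simp add: abs_square_le_1)
    show "(\<Sum>j\<le>m. (c j)\<^sup>2) \<le> 2 / pi * cheb_integral (p * p)"
      unfolding sq sum_distrib_left by (intro sum_mono) auto
    show "0 \<le> 2 / pi * cheb_integral (p * p)"
      unfolding sq by (simp add: sum_nonneg)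
  qed (simp add: sum_nonneg)
  finally show ?thesis by (simp add: algebra_simps)
qed

text \<open>A closed form would require care near the zeros of sin t. Instead, the squared modulus
  of the sum of e^(2ikt) over k < N is nonnegative, so the double sum of cos^2 ((j - k) t) is at
  least N^2 / 2, while each of its N rows is at most twice the sum in question.\<close>

lemma sum_cos_square_ge: "real N / 4 \<le> (\<Sum>l<N. (cos (real l * t))\<^sup>2)"
proof (cases "N = 0")
  case False
  let ?S = "\<Sum>l<N. (cos (real l * t))\<^sup>2"
  \<comment> \<open>On each side of the diagonal, k \<le> j or k > j, the index |j - k| is injective
    in k and less than N. A full row may meet an index twice.\<close>
  have half: "(\<Sum>k\<in>A. (cos ((real j - real k) * t))\<^sup>2) \<le> ?S"
    if f: "inj_on f A" "f ` A \<subseteq> {..<N}"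
      "\<And>k. k \<in> A \<Longrightarrow> real (f k) = real j - real k \<or> real (f k) = - (real j - real k)" for f A j
  proof -
    have "(\<Sum>k\<in>A. (cos ((real j - real k) * t))\<^sup>2) = (\<Sum>k\<in>A. (cos (real (f k) * t))\<^sup>2)"
    proof (rule sum.cong)
      fix k assume "k \<in> A"
      from f(3)[OF this] show "(cos ((real j - real k) * t))\<^sup>2 = (cos (real (f k) * t))\<^sup>2"
        using cos_minus[of "(real j - real k) * t"] by (metis mult_minus_left)
    qed simp
    also have "\<dots> = (\<Sum>l\<in>f ` A. (cos (real l * t))\<^sup>2)" by (simp add: sum.reindex f(1))
    also have "\<dots> \<le> ?S" using f(2) by (intro sum_mono2) auto
    finally show ?thesis .
  qed
  have row: "(\<Sum>k<N. (cos ((real j - real k) * t))\<^sup>2) \<le> 2 * ?S" if j: "j < N" for j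
  proof -
    have "{..<N} = {..j} \<union> {j<..<N}" using j by auto
    then have "(\<Sum>k<N. (cos ((real j - real k) * t))\<^sup>2) =
        (\<Sum>k\<le>j. (cos ((real j - real k) * t))\<^sup>2) + (\<Sum>k\<in>{j<..<N}. (cos ((real j - real k) * t))\<^sup>2)"
      by (simp add: sum.union_disjoint disjoint_iff)
    also have "(\<Sum>k\<le>j. (cos ((real j - real k) * t))\<^sup>2) \<le> ?S"
      using j by (intro half[of "\<lambda>k. j - k"]) (auto intro!: inj_onI simp: of_nat_diff)
    also have "(\<Sum>k\<in>{j<..<N}. (cos ((real j - real k) * t))\<^sup>2) \<le> ?S"
      using j by (intro half[of "\<lambda>k. k - j"]) (auto intro!: inj_onI simp: of_nat_diff)
    finally show ?thesis by simp
  qed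
  have "0 \<le> (\<Sum>k<N. cos (real k * (2 * t)))\<^sup>2 + (\<Sum>k<N. sin (real k * (2 * t)))\<^sup>2" by simp
  also have "\<dots> = (\<Sum>j<N. \<Sum>k<N. cos (real j * (2 * t) - real k * (2 * t)))"
    by (simp add: power2_eq_square sum_product sum.distrib cos_diff)
  also have "\<dots> = (\<Sum>j<N. \<Sum>k<N. 2 * (cos ((real j - real k) * t))\<^sup>2 - 1)"
  proof (intro sum.cong refl)
    fix j k
    have "real j * (2 * t) - real k * (2 * t) = 2 * ((real j - real k) * t)" by (simp add: algebra_simps)
    then show "cos (real j * (2 * t) - real k * (2 * t)) = 2 * (cos ((real j - real k) * t))\<^sup>2 - 1"
      using cos_double_cos[of "(real j - real k) * t"] by simp
  qed
  also have "\<dots> = 2 * (\<Sum>j<N. \<Sum>k<N. (cos ((real j - real k) * t))\<^sup>2) - real N * real N"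
    by (simp add: sum_subtractf sum_distrib_left)
  also have "(\<Sum>j<N. \<Sum>k<N. (cos ((real j - real k) * t))\<^sup>2) \<le> (\<Sum>j<N. 2 * ?S)"
    using row by (intro sum_mono) auto
  finally have "real N * real N \<le> real N * (4 * ?S)" by simp
  then show ?thesis using False by simp
qed simp

text \<open>The witness is the sum of T_j(y) T_j over j \<le> m, divided by its value S at y. This
  is the reproducing kernel up to the different norm of T_0, which only affects the
  constant.\<close>

lemma cheb_peak_exists:
  assumes "y \<in> {-1..1}"
  shows "\<exists>q. degree q \<le> m \<and> poly q y = 1 \<and> cheb_integral (q * q) \<le> 4 * pi / real (m + 1)"
proof -
  define S where "S = (\<Sum>j\<le>m. (poly (cheb j) y)\<^sup>2)"
  have S: "real (m + 1) / 4 \<le> S"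
    using sum_cos_square_ge[of "m + 1" "arccos y"] assms by (simp add: S_def poly_cheb_arccos lessThan_Suc_atMost)
  then have "S > 0" by (rule less_le_trans[rotated]) simp
  define q where "q = (\<Sum>j\<le>m. smult (poly (cheb j) y / S) (cheb j))"
  have "degree q \<le> m"
    unfolding q_def using degree_coeff_cheb by (intro degree_sum_le) (auto intro: order.trans[OF degree_smult_le])
  moreover have "poly q y = 1"
    using \<open>S > 0\<close> unfolding q_def
    by (simp add: poly_sum flip: power2_eq_square sum_divide_distrib) (simp add: S_def)
  moreover have "cheb_integral (q * q) \<le> (\<Sum>j\<le>m. (poly (cheb j) y / S)\<^sup>2 * pi)"
    unfolding q_def cheb_integral_square by (intro sum_mono mult_left_mono) auto
  moreover have "(\<Sum>j\<le>m. (poly (cheb j) y / S)\<^sup>2 * pi) = (\<Sum>j\<le>m. (poly (cheb j) y)\<^sup>2) / S\<^sup>2 * pi"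
    by (simp add: power_divide sum_divide_distrib sum_distrib_right)
  then have "(\<Sum>j\<le>m. (poly (cheb j) y / S)\<^sup>2 * pi) = pi / S"
    using \<open>S > 0\<close> unfolding S_def[symmetric] by (simp add: power2_eq_square)
  moreover have "pi / S \<le> pi / (real (m + 1) / 4)" using S \<open>S > 0\<close> by (intro divide_left_mono) auto
  ultimately show ?thesis by (intro exI[of _ q]) (simp add: mult.commute)
qed

section \<open>Jackson's theorem\<close>

lemma poly_eq_sum_atMost:
  fixes p :: "'a::comm_semiring_1 poly"
  assumes "degree p \<le> m"
  shows "poly p x = (\<Sum>i\<le>m. coeff p i * x ^ i)"
  unfolding poly_altdef by (rule sum.mono_neutral_left) (use assms in \<open>auto simp: coeff_eq_0\<close>)

lemma degree_map_poly_le: "f 0 = 0 \<Longrightarrow> degree (map_poly f p) \<le> degree p"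
  by (intro degree_le) (simp add: coeff_map_poly coeff_eq_0)

text \<open>A squared modulus on the unit circle is a trigonometric polynomial that is visibly
  nonnegative. For p = 1 + z + ... + z^(N-1) it is N times the Fejer kernel, and for p^2 a multiple
  of the Jackson kernel.\<close>

definition trig_kernel :: "real poly \<Rightarrow> real \<Rightarrow> real" where
  "trig_kernel p t = (cmod (poly (map_poly of_real p) (cis t)))\<^sup>2"

lemma trig_kernel_nonneg: "0 \<le> trig_kernel p t"
  by (simp add: trig_kernel_def)

lemma trig_kernel_mult: "trig_kernel (p * q) t = trig_kernel p t * trig_kernel q t"
  by (simp add: trig_kernel_def map_poly_of_real_mult norm_mult power_mult_distrib)

lemma trig_kernel_eq_cos_sum:
  assumes "degree p \<le> m"
  shows "trig_kernel p t = (\<Sum>j\<le>m. \<Sum>k\<le>m. coeff p j * coeff p k * cos ((real j - real k) * t))"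
proof -
  have "poly (map_poly of_real p) (cis t) = (\<Sum>j\<le>m. of_real (coeff p j) * cis (real j * t))"
    using assms
    by (subst poly_eq_sum_atMost[of _ m]) (simp_all add: coeff_map_poly Complex.DeMoivre degree_map_poly)
  then have "trig_kernel p t = (\<Sum>j\<le>m. coeff p j * cos (real j * t))\<^sup>2 + (\<Sum>j\<le>m. coeff p j * sin (real j * t))\<^sup>2"
    by (simp add: trig_kernel_def cmod_power2)
  also have "\<dots> = (\<Sum>j\<le>m. \<Sum>k\<le>m. coeff p j * coeff p k * cos (real j * t - real k * t))"
    by (simp add: power2_eq_square sum_product sum.distrib[symmetric] cos_diff algebra_simps)
  finally show ?thesis by (simp add: left_diff_distrib)
qed

definition root_angle :: "nat \<Rightarrow> nat \<Rightarrow> real" where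
  "root_angle M i = 2 * pi * real i / real M"

lemma sum_cis_root_angle:
  assumes "0 < l" "l < M"
  shows "(\<Sum>i<M. cis (real l * root_angle M i)) = 0"
proof -
  define z where "z = cis (2 * pi * real l / real M)"
  have "z ^ M = 1"
    using assms by (simp add: z_def Complex.DeMoivre)
  moreover have "z \<noteq> 1"
  proof
    assume "z = 1"
    then have "cos (2 * pi * real l / real M) = 1" by (simp add: z_def complex_eq_iff)
    then obtain n :: int where "2 * pi * real l / real M = of_int n * 2 * pi"
      unfolding cos_one_2pi_int by auto
    then have "real l = of_int n * real M" using assms by (simp add: field_simps)
    then have "int l = n * int M" by (metis of_int_eq_iff of_int_mult of_int_of_nat_eq)
    then have "int M dvd int l" by simp
    then show False using assms zdvd_imp_le by fastforce
  qed
  moreover have "cis (real l * root_angle M i) = z ^ i" for i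
    by (simp add: z_def Complex.DeMoivre root_angle_def algebra_simps)
  ultimately show ?thesis by (simp add: geometric_sum)
qed

lemma sum_cos_root_angle:
  assumes "0 < l" "l < M" "s = 1 \<or> s = -1"
  shows "(\<Sum>i<M. cos (real l * (t + s * root_angle M i))) = 0"
proof -
  have c: "(\<Sum>i<M. cos (real l * root_angle M i)) = 0" "(\<Sum>i<M. sin (real l * root_angle M i)) = 0"
    using sum_cis_root_angle[OF assms(1,2)] by (simp_all add: complex_eq_iff)
  have "cos (real l * (t + s * root_angle M i)) =
      cos (real l * t) * cos (real l * root_angle M i) - s * sin (real l * t) * sin (real l * root_angle M i)" for i
    using assms(3) by (auto simp: ring_distribs cos_add cos_diff)
  then show ?thesis using c by (simp add: sum_subtractf flip: sum_distrib_left)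
qed

text \<open>All frequencies |j - k| are at most m < M, so summation over M equidistant points leaves
  only the diagonal j = k. Both signs \<open>s\<close> occur in the symmetrization.\<close>

lemma sum_trig_kernel:
  assumes "degree p \<le> m" "m < M" "s = 1 \<or> s = -1"
  shows "(\<Sum>i<M. trig_kernel p (t + s * root_angle M i)) = real M * (\<Sum>j\<le>m. (coeff p j)\<^sup>2)"
proof -
  have cos: "(\<Sum>i<M. cos ((real j - real k) * (t + s * root_angle M i))) = (if k = j then real M else 0)"
    if jk: "j \<le> m" "k \<le> m" for j k
  proof -
    have *: "(\<Sum>i<M. cos ((real j - real k) * (t + s * root_angle M i))) = 0" if "k < j" "j \<le> m" for j k
      using sum_cos_root_angle[of "j - k" M s t] that assms by (simp add: of_nat_diff)
    have "cos ((real j - real k) * u) = cos ((real k - real j) * u)" for u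
      using cos_minus[of "(real j - real k) * u"] by (simp add: left_diff_distrib)
    then show ?thesis using *[of k j] *[of j k] jk by (cases k j rule: linorder_cases) auto
  qed
  have "(\<Sum>i<M. trig_kernel p (t + s * root_angle M i)) =
    (\<Sum>j\<le>m. \<Sum>k\<le>m. coeff p j * coeff p k * (\<Sum>i<M. cos ((real j - real k) * (t + s * root_angle M i))))"
    unfolding trig_kernel_eq_cos_sum[OF assms(1)] sum_distrib_left
    by (subst sum.swap, rule sum.cong[OF refl], rule sum.swap)
  also have "\<dots> = (\<Sum>j\<le>m. \<Sum>k\<le>m. if k = j then real M * (coeff p j)\<^sup>2 else 0)"
    using cos by (intro sum.cong) (auto simp: power2_eq_square)
  finally show ?thesis by (simp add: sum_distrib_left)
qed

text \<open>Adding the reflected shift makes the kernel even in t: with a = j - k, cos (a (t - u)) +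
  cos (a (t + u)) = 2 cos (a u) cos (a t), a multiple of a Chebyshev polynomial in cos t.\<close>

lemma trig_kernel_symmetrized_poly:
  assumes "degree p \<le> m"
  shows "\<exists>r. degree r \<le> m \<and> (\<forall>t. poly r (cos t) = trig_kernel p (t - u) + trig_kernel p (t + u))"
proof -
  define d where "d j k = (if j \<le> k then k - j else j - k)" for j k :: nat
  let ?r = "\<Sum>j\<le>m. \<Sum>k\<le>m. smult (2 * coeff p j * coeff p k * cos ((real j - real k) * u)) (cheb (d j k))"
  have "degree ?r \<le> m"
    using degree_coeff_cheb by (intro degree_sum_le) (auto simp: d_def intro!: order.trans[OF degree_smult_le])
  moreover have "poly ?r (cos t) = trig_kernel p (t - u) + trig_kernel p (t + u)" for t
  proof -
    have d: "cos (real (d j k) * t) = cos ((real j - real k) * t)" for j k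
      using cos_minus[of "(real j - real k) * t"] by (auto simp: d_def of_nat_diff left_diff_distrib)
    show ?thesis
      unfolding poly_sum poly_smult poly_cheb_cos d trig_kernel_eq_cos_sum[OF assms] sum.distrib[symmetric]
      by (intro sum.cong refl) (simp add: cos_add cos_diff ring_distribs)
  qed
  ultimately show ?thesis by blast
qed

text \<open>Telescoping: (1 - z) times the geometric sum is 1 - z^N, of modulus at most 2.\<close>

lemma geometric_kernel_bound:
  "trig_kernel (\<Sum>j<N. monom 1 j) t * (cmod (1 - cis t))\<^sup>2 \<le> 4"
proof -
  have "poly (map_poly of_real (\<Sum>j<N. monom 1 j)) z = (\<Sum>j<N. z ^ j)" for z :: complex
    by (induction N) (simp_all add: map_poly_of_real_add map_poly_monom poly_monom)
  then have "trig_kernel (\<Sum>j<N. monom 1 j) t * (cmod (1 - cis t))\<^sup>2 = (cmod (1 - cis t ^ N))\<^sup>2"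
    unfolding trig_kernel_def one_diff_power_eq[of "cis t" N] by (simp add: norm_mult power_mult_distrib)
  also have "\<dots> \<le> 2\<^sup>2"
    using norm_triangle_ineq4[of 1 "cis t ^ N"] by (intro power_mono) (auto simp: norm_power)
  finally show ?thesis by simp
qed

lemma abs_cos_diff_le_cis: "\<bar>cos t - cos u\<bar> \<le> cmod (1 - cis (t - u))"
proof -
  have "cis u * (1 - cis (t - u)) = cis u - cis t" by (simp add: right_diff_distrib cis_mult)
  then have "cmod (1 - cis (t - u)) = cmod (cis u - cis t)" by (metis mult_1 norm_cis norm_mult)
  then show ?thesis using abs_Re_le_cmod[of "cis u - cis t"] by simp
qed

text \<open>
  The convolution with the Jackson kernel \<open>trig_kernel (q * q)\<close> is replaced by an average over the
  \<open>M\<close>-th roots of unity, which is exact because the degree of the kernel is less than \<open>M\<close>.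
\<close>

lemma jackson_approximation:
  fixes f :: "real \<Rightarrow> complex"
  assumes f: "\<And>u v. u \<in> {-1..1} \<Longrightarrow> v \<in> {-1..1} \<Longrightarrow> cmod (f u - f v) \<le> \<alpha> + \<beta> * (u - v)\<^sup>2"
    and "0 < N" "0 \<le> \<beta>"
  shows "\<exists>p. degree p \<le> 2 * N - 2 \<and>
    (\<forall>x\<in>{-1..1}. cmod (poly p (of_real x) - f x) \<le> \<alpha> + 8 * \<beta> / (real N)\<^sup>2)"
proof -
  define q :: "real poly" where "q = (\<Sum>j<N. monom 1 j)"
  define m where "m = 2 * N - 2"
  define M where "M = m + 1"
  let ?\<phi> = "root_angle M"
  define J where "J = trig_kernel (q * q)"
  define S where "S = (\<Sum>j\<le>m. (coeff (q * q) j)\<^sup>2)"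
  have M: "m < M" "0 < M" by (simp_all add: M_def)
  have dq: "degree q \<le> N - 1"
    unfolding q_def by (intro degree_sum_le) (auto intro: order.trans[OF degree_monom_le])
  then have dqq: "degree (q * q) \<le> m"
    using degree_mult_le[of q q] by (simp add: m_def)
  have coeff_q: "coeff q j = (if j < N then 1 else 0)" for j
    by (simp add: q_def coeff_sum)
  \<comment> \<open>Evaluation at 1 gives the coefficient sum N^2. There are 2N - 1 coefficients, so
    Cauchy-Schwarz yields S \<ge> N^3 / 2.\<close>
  have "real N ^ 2 = (\<Sum>j\<le>m. coeff (q * q) j)"
    using poly_eq_sum_atMost[OF dqq, of 1] by (simp add: q_def poly_sum poly_monom power2_eq_square)
  then have "real N ^ 4 = (\<Sum>j\<le>m. 1 * coeff (q * q) j)\<^sup>2" by (metis (no_types) mult_1 numeral_Bit0 power_add power2_eq_square sum.cong)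
  also have "\<dots> \<le> (\<Sum>j\<le>m. 1\<^sup>2) * S" unfolding S_def by (rule Cauchy_Schwarz_ineq_sum)
  also have "\<dots> \<le> 2 * real N * S"
    using \<open>0 < N\<close> by (intro mult_right_mono) (auto simp: S_def m_def sum_nonneg)
  finally have S: "real N ^ 3 \<le> 2 * S" using \<open>0 < N\<close> by (simp add: eval_nat_numeral)
  moreover have "real N ^ 3 > 0" using \<open>0 < N\<close> by simp
  ultimately have "S > 0" by linarith
  have total: "(\<Sum>i<M. J (t + s * ?\<phi> i)) = real M * S" if "s = 1 \<or> s = -1" for s t
    unfolding J_def S_def by (rule sum_trig_kernel[OF dqq M(1) that])
  \<comment> \<open>One of the two factors \<open>trig_kernel q\<close> of \<open>J\<close> absorbs
    |1 - z|^2 up to the constant 4; the other has average N. Relative to the total mass M S, the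
    second moment is at most 8 / N^2.\<close>
  have moment: "(\<Sum>i<M. (cmod (1 - cis (t + s * ?\<phi> i)))\<^sup>2 * J (t + s * ?\<phi> i)) \<le> 4 * real M * real N"
    if "s = 1 \<or> s = -1" for s t
  proof -
    have "(\<Sum>i<M. (cmod (1 - cis (t + s * ?\<phi> i)))\<^sup>2 * J (t + s * ?\<phi> i)) \<le> (\<Sum>i<M. 4 * trig_kernel q (t + s * ?\<phi> i))"
    proof (rule sum_mono)
      fix i
      show "(cmod (1 - cis (t + s * ?\<phi> i)))\<^sup>2 * J (t + s * ?\<phi> i) \<le> 4 * trig_kernel q (t + s * ?\<phi> i)"
        using mult_right_mono[OF geometric_kernel_bound[of N "t + s * ?\<phi> i"] trig_kernel_nonneg[of q "t + s * ?\<phi> i"]]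
        by (simp add: J_def trig_kernel_mult q_def ac_simps)
    qed
    also have "\<dots> = 4 * (real M * (\<Sum>j\<le>N - 1. (coeff q j)\<^sup>2))"
      using dq that by (subst sum_trig_kernel[symmetric, of q "N - 1"]) (auto simp: sum_distrib_left M_def m_def)
    also have "(\<Sum>j\<le>N - 1. (coeff q j)\<^sup>2) = (\<Sum>j\<le>N - 1. 1)"
      using \<open>0 < N\<close> by (intro sum.cong refl) (simp add: coeff_q)
    finally show ?thesis using \<open>0 < N\<close> by (simp add: of_nat_diff)
  qed
  \<comment> \<open>As the bound on f is quadratic in u - v, only the mass and the second moment of
    \<open>J\<close> enter the error.\<close>
  have err: "(\<Sum>i<M. J (t + s * ?\<phi> i) * cmod (f (cos (?\<phi> i)) - f (cos t))) \<le> real M * S * (\<alpha> + 8 * \<beta> / (real N)\<^sup>2)"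
    if s: "s = 1 \<or> s = -1" for s t
  proof -
    have "(\<Sum>i<M. J (t + s * ?\<phi> i) * cmod (f (cos (?\<phi> i)) - f (cos t))) \<le>
      (\<Sum>i<M. J (t + s * ?\<phi> i) * (\<alpha> + \<beta> * (cmod (1 - cis (t + s * ?\<phi> i)))\<^sup>2))"
    proof (intro sum_mono mult_left_mono)
      fix i
      have "\<bar>cos (?\<phi> i) - cos t\<bar> \<le> cmod (1 - cis (t + s * ?\<phi> i))"
        using s abs_cos_diff_le_cis[of t "- s * ?\<phi> i"] by (auto simp: abs_minus_commute)
      then have "(cos (?\<phi> i) - cos t)\<^sup>2 \<le> (cmod (1 - cis (t + s * ?\<phi> i)))\<^sup>2"
        by (simp add: abs_le_square_iff[symmetric])
      then have "\<beta> * (cos (?\<phi> i) - cos t)\<^sup>2 \<le> \<beta> * (cmod (1 - cis (t + s * ?\<phi> i)))\<^sup>2"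
        using \<open>0 \<le> \<beta>\<close> by (rule mult_left_mono)
      moreover have "cmod (f (cos (?\<phi> i)) - f (cos t)) \<le> \<alpha> + \<beta> * (cos (?\<phi> i) - cos t)\<^sup>2"
        by (rule f) auto
      ultimately show "cmod (f (cos (?\<phi> i)) - f (cos t)) \<le> \<alpha> + \<beta> * (cmod (1 - cis (t + s * ?\<phi> i)))\<^sup>2" by linarith
    qed (simp add: J_def trig_kernel_nonneg)
    also have "\<dots> = \<alpha> * (\<Sum>i<M. J (t + s * ?\<phi> i)) + \<beta> * (\<Sum>i<M. (cmod (1 - cis (t + s * ?\<phi> i)))\<^sup>2 * J (t + s * ?\<phi> i))"
      by (simp add: sum_distrib_left sum.distrib[symmetric] algebra_simps)
    also have "\<dots> \<le> \<alpha> * (real M * S) + \<beta> * (4 * real M * real N)"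
      unfolding total[OF s] using moment[OF s] \<open>0 \<le> \<beta>\<close> by (intro add_left_mono mult_left_mono)
    also have "\<beta> * (4 * real M * real N) \<le> \<beta> * (real M * S * (8 / (real N)\<^sup>2))"
    proof (rule mult_left_mono[OF _ \<open>0 \<le> \<beta>\<close>])
      have "4 * real N * (real N)\<^sup>2 \<le> 8 * S" using S by (simp add: eval_nat_numeral)
      then have "4 * real N \<le> S * (8 / (real N)\<^sup>2)" using \<open>0 < N\<close> by (simp add: field_simps)
      then have "real M * (4 * real N) \<le> real M * (S * (8 / (real N)\<^sup>2))" by (rule mult_left_mono) simp
      then show "4 * real M * real N \<le> real M * S * (8 / (real N)\<^sup>2)" by (simp add: mult_ac)
    qed
    finally show ?thesis by (simp add: algebra_simps)
  qed
  have "\<forall>i. \<exists>r. degree r \<le> m \<and> (\<forall>t. poly r (cos t) = J (t - ?\<phi> i) + J (t + ?\<phi> i))"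
    unfolding J_def using trig_kernel_symmetrized_poly[OF dqq] by blast
  then obtain r where r: "\<And>i. degree (r i) \<le> m" "\<And>i t. poly (r i) (cos t) = J (t - ?\<phi> i) + J (t + ?\<phi> i)"
    by metis
  \<comment> \<open>Division by 2 M S, the mass of both reflected families together, makes each
    value of \<open>p\<close> on the interval a convex combination of samples of f.\<close>
  define p where "p = (\<Sum>i<M. smult (f (cos (?\<phi> i)) / of_real (2 * real M * S)) (map_poly of_real (r i)))"
  have "degree p \<le> m"
    unfolding p_def using r(1)
    by (intro degree_sum_le) (auto intro!: order.trans[OF degree_smult_le] order.trans[OF degree_map_poly_le])
  moreover have "cmod (poly p (of_real x) - f x) \<le> \<alpha> + 8 * \<beta> / (real N)\<^sup>2" if x: "x \<in> {-1..1}" for x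
  proof -
    define t where "t = arccos x"
    have xt: "x = cos t" using x by (simp add: t_def)
    define c where "c = 2 * real M * S"
    have "c > 0" using M \<open>S > 0\<close> by (simp add: c_def)
    have tot: "(\<Sum>i<M. J (t - ?\<phi> i) + J (t + ?\<phi> i)) = c"
      using total[of "-1" t] total[of 1 t] by (simp add: sum.distrib c_def)
    have px: "poly p (of_real x) = (\<Sum>i<M. f (cos (?\<phi> i)) * of_real (J (t - ?\<phi> i) + J (t + ?\<phi> i))) / of_real c"
      unfolding p_def xt c_def by (simp add: poly_sum poly_map_poly_of_real r(2) sum_divide_distrib)
    have fx: "f x = (\<Sum>i<M. f x * of_real (J (t - ?\<phi> i) + J (t + ?\<phi> i))) / of_real c"
      using \<open>c > 0\<close> unfolding sum_distrib_left[symmetric] of_real_sum[symmetric] tot by simp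
    have "poly p (of_real x) - f x =
        (\<Sum>i<M. f (cos (?\<phi> i)) * of_real (J (t - ?\<phi> i) + J (t + ?\<phi> i))) / of_real c -
        (\<Sum>i<M. f x * of_real (J (t - ?\<phi> i) + J (t + ?\<phi> i))) / of_real c"
      by (rule arg_cong2[where f = minus, OF px fx])
    also have "\<dots> = (\<Sum>i<M. (f (cos (?\<phi> i)) - f x) * of_real (J (t - ?\<phi> i) + J (t + ?\<phi> i))) / of_real c"
      by (simp only: diff_divide_distrib[symmetric] sum_subtractf[symmetric] left_diff_distrib[symmetric])
    finally have "cmod (poly p (of_real x) - f x) =
        cmod (\<Sum>i<M. (f (cos (?\<phi> i)) - f x) * of_real (J (t - ?\<phi> i) + J (t + ?\<phi> i))) / c"
      using \<open>c > 0\<close> by (simp only: norm_divide norm_of_real abs_of_pos)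
    also have "\<dots> \<le> (\<Sum>i<M. cmod (f (cos (?\<phi> i)) - f (cos t)) * (J (t - ?\<phi> i) + J (t + ?\<phi> i))) / c"
    proof (rule divide_right_mono[OF sum_norm_le])
      fix i
      have "0 \<le> J (t - ?\<phi> i) + J (t + ?\<phi> i)" by (simp add: J_def trig_kernel_nonneg)
      then show "cmod ((f (cos (?\<phi> i)) - f x) * of_real (J (t - ?\<phi> i) + J (t + ?\<phi> i))) \<le>
          cmod (f (cos (?\<phi> i)) - f (cos t)) * (J (t - ?\<phi> i) + J (t + ?\<phi> i))"
        by (simp only: norm_mult norm_of_real abs_of_nonneg xt)
    qed (use \<open>c > 0\<close> in simp)
    also have "\<dots> = ((\<Sum>i<M. J (t - ?\<phi> i) * cmod (f (cos (?\<phi> i)) - f (cos t))) +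
        (\<Sum>i<M. J (t + ?\<phi> i) * cmod (f (cos (?\<phi> i)) - f (cos t)))) / c"
      by (simp add: ring_distribs sum.distrib mult.commute)
    also have "\<dots> \<le> (2 * (real M * S * (\<alpha> + 8 * \<beta> / (real N)\<^sup>2))) / c"
      unfolding mult_2 using err[of "-1" t] err[of 1 t] \<open>c > 0\<close>
      by (intro divide_right_mono add_mono) auto
    also have "\<dots> = \<alpha> + 8 * \<beta> / (real N)\<^sup>2"
      using M \<open>S > 0\<close> by (simp add: c_def)
    finally show ?thesis .
  qed
  ultimately show ?thesis unfolding m_def by blast
qed

section \<open>Convergence of the interpolation polynomials\<close>

text \<open>Close points are controlled by the little-o hypothesis; for points at distance at least
  d / 2, the bound 2 K is absorbed into the quadratic term.\<close>

lemma modulus_cont_quadratic_bound: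
  fixes f :: "real \<Rightarrow> complex"
  assumes cont: "continuous_on {-1..1} f"
    and small: "modulus_cont f \<in> o[at_right 0](\<lambda>\<delta>. \<delta> powr (1/2))" and "\<epsilon> > 0"
  shows "\<exists>B\<ge>0. \<forall>u\<in>{-1..1}. \<forall>v\<in>{-1..1}. cmod (f u - f v) \<le> \<epsilon> * sqrt \<bar>u - v\<bar> + B * (u - v)\<^sup>2"
proof -
  have "compact (f ` {-1..1})" using cont by (intro compact_continuous_image) auto
  then obtain K where "\<forall>y\<in>f ` {-1..1}. cmod y \<le> K"
    using compact_imp_bounded bounded_iff by metis
  then have K: "cmod (f x) \<le> K" if "x \<in> {-1..1}" for x using that by blast
  have "0 \<le> K" using order.trans[OF norm_ge_zero K[of 0]] by simp
  have diff: "cmod (f u - f v) \<le> 2 * K" if "u \<in> {-1..1}" "v \<in> {-1..1}" for u v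
    using norm_triangle_ineq4[of "f u" "f v"] K[OF that(1)] K[OF that(2)] by linarith
  have "\<forall>\<^sub>F \<delta> in at_right 0. norm (modulus_cont f \<delta>) \<le> \<epsilon> / 2 * norm (\<delta> powr (1/2))"
    using \<open>\<epsilon> > 0\<close> by (intro landau_o.smallD[OF small]) simp
  then obtain d where d: "d > 0" "\<And>\<delta>. 0 < \<delta> \<Longrightarrow> \<delta> < d \<Longrightarrow> \<bar>modulus_cont f \<delta>\<bar> \<le> \<epsilon> / 2 * sqrt \<delta>"
    unfolding eventually_at_right_field by (auto simp: powr_half_sqrt)
  define B where "B = 8 * K / d\<^sup>2"
  have "B \<ge> 0" using \<open>0 \<le> K\<close> by (simp add: B_def)
  moreover have "cmod (f u - f v) \<le> \<epsilon> * sqrt \<bar>u - v\<bar> + B * (u - v)\<^sup>2"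
    if uv: "u \<in> {-1..1}" "v \<in> {-1..1}" for u v
  proof (cases "2 * \<bar>u - v\<bar> < d")
    case True
    show ?thesis
    proof (cases "u = v")
      case False
      \<comment> \<open>The strict inequality in \<open>modulus_cont\<close> excludes \<delta> = |u
        - v|. Doubling costs sqrt 2 \<le> 2, for which the factor \<epsilon> / 2 makes room.\<close>
      let ?\<delta> = "2 * \<bar>u - v\<bar>"
      have "cmod (f u - f v) \<le> modulus_cont f ?\<delta>"
        unfolding modulus_cont_def
      proof (rule cSup_upper)
        show "bdd_above {cmod (f s - f t) |s t. s \<in> {-1..1} \<and> t \<in> {-1..1} \<and> \<bar>s - t\<bar> < ?\<delta>}"
          using diff by (intro bdd_aboveI[of _ "2 * K"]) auto
        show "cmod (f u - f v) \<in> {cmod (f s - f t) |s t. s \<in> {-1..1} \<and> t \<in> {-1..1} \<and> \<bar>s - t\<bar> < ?\<delta>}"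
          using uv False by force
      qed
      also have "\<dots> \<le> \<epsilon> / 2 * sqrt ?\<delta>" using d(2)[of ?\<delta>] False True by force
      also have "\<dots> \<le> \<epsilon> / 2 * (2 * sqrt \<bar>u - v\<bar>)"
      proof (rule mult_left_mono)
        show "sqrt ?\<delta> \<le> 2 * sqrt \<bar>u - v\<bar>"
          by (intro real_le_lsqrt) (auto simp: power_mult_distrib)
      qed (use \<open>\<epsilon> > 0\<close> in simp)
      also have "\<dots> \<le> \<epsilon> * sqrt \<bar>u - v\<bar> + B * (u - v)\<^sup>2" using \<open>B \<ge> 0\<close> by simp
      finally show ?thesis .
    qed simp
  next
    case False
    then have "d\<^sup>2 \<le> (2 * \<bar>u - v\<bar>)\<^sup>2" using d(1) by (intro power_mono) auto
    then have "d\<^sup>2 \<le> 4 * (u - v)\<^sup>2" by (simp add: power_mult_distrib)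
    then have "K * d\<^sup>2 \<le> K * (4 * (u - v)\<^sup>2)" using \<open>0 \<le> K\<close> by (rule mult_left_mono)
    then have "2 * K \<le> B * (u - v)\<^sup>2" using d(1) by (simp add: B_def field_simps)
    then have "cmod (f u - f v) \<le> B * (u - v)\<^sup>2" using diff[OF uv] by linarith
    then show ?thesis using \<open>\<epsilon> > 0\<close> by (simp add: add_increasing)
  qed
  ultimately show ?thesis by blast
qed

text \<open>The inequality y \<le> 1 + y^4 with y^2 = N |u - v| bounds sqrt |u - v| by (1 + N^2 (u -
  v)^2) / sqrt N, which has the quadratic form required by the Jackson estimate.\<close>

lemma jackson_little_o:
  fixes f :: "real \<Rightarrow> complex"
  assumes cont: "continuous_on {-1..1} f"
    and small: "modulus_cont f \<in> o[at_right 0](\<lambda>\<delta>. \<delta> powr (1/2))" and "\<epsilon> > 0"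
  shows "\<forall>\<^sub>F N in sequentially. \<exists>p. degree p \<le> 2 * N - 2 \<and>
    (\<forall>x\<in>{-1..1}. cmod (poly p (of_real x) - f x) \<le> \<epsilon> / sqrt (real N))"
proof -
  \<comment> \<open>The Jackson estimate multiplies \<open>?e / sqrt N\<close> by 1 + 8 = 9, which
    leaves half of \<epsilon> / sqrt N for the term 8 B / N^2.\<close>
  let ?e = "\<epsilon> / 18"
  obtain B where B: "B \<ge> 0" "\<And>u v. u \<in> {-1..1} \<Longrightarrow> v \<in> {-1..1} \<Longrightarrow>
      cmod (f u - f v) \<le> ?e * sqrt \<bar>u - v\<bar> + B * (u - v)\<^sup>2"
    using modulus_cont_quadratic_bound[OF cont small, of ?e] \<open>\<epsilon> > 0\<close> by auto
  have "\<forall>\<^sub>F N in sequentially. N \<ge> nat \<lceil>16 * B / \<epsilon>\<rceil> + 1" by (rule eventually_ge_at_top)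
  then show ?thesis
  proof eventually_elim
    case (elim N)
    then have N: "real N \<ge> 1" "16 * B / \<epsilon> \<le> real N" by linarith+
    define r where "r = sqrt (real N)"
    have r: "r \<ge> 1" "r\<^sup>2 = real N" using N by (simp_all add: r_def)
    define \<alpha> where "\<alpha> = ?e / r"
    define \<beta> where "\<beta> = ?e / r * (real N)\<^sup>2 + B"
    have "cmod (f u - f v) \<le> \<alpha> + \<beta> * (u - v)\<^sup>2" if uv: "u \<in> {-1..1}" "v \<in> {-1..1}" for u v
    proof -
      define s where "s = sqrt \<bar>u - v\<bar>"
      have s: "s \<ge> 0" "s\<^sup>2 = \<bar>u - v\<bar>" by (simp_all add: s_def)
      have quartic: "y \<le> 1 + y ^ 4" if "y \<ge> 0" for y :: real
      proof (cases "y \<le> 1")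
        case False
        then show ?thesis using power_increasing[of 1 4 y] by simp
      qed (use zero_le_power[OF that, of 4] in linarith)
      have "(r * s) ^ 4 = (r\<^sup>2)\<^sup>2 * (s\<^sup>2)\<^sup>2" by (simp add: power_mult_distrib)
      also have "\<dots> = (real N)\<^sup>2 * (u - v)\<^sup>2" by (simp only: r(2) s(2) power2_abs)
      finally have "r * s \<le> 1 + (real N)\<^sup>2 * (u - v)\<^sup>2" using quartic[of "r * s"] r(1) s(1) by simp
      then have "s \<le> (1 + (real N)\<^sup>2 * (u - v)\<^sup>2) / r" using r by (simp add: field_simps)
      then have "?e * s \<le> ?e * ((1 + (real N)\<^sup>2 * (u - v)\<^sup>2) / r)"
        using \<open>\<epsilon> > 0\<close> by (intro mult_left_mono) auto
      then have "?e * s + B * (u - v)\<^sup>2 \<le> \<alpha> + \<beta> * (u - v)\<^sup>2"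
        using r by (simp add: \<alpha>_def \<beta>_def field_simps)
      then show ?thesis using B(2)[OF uv] by (simp add: s_def)
    qed
    from jackson_approximation[of f \<alpha> \<beta> N, OF this]
    obtain p where p: "degree p \<le> 2 * N - 2"
      "\<And>x. x \<in> {-1..1} \<Longrightarrow> cmod (poly p (of_real x) - f x) \<le> \<alpha> + 8 * \<beta> / (real N)\<^sup>2"
      using N B(1) r \<open>\<epsilon> > 0\<close> by (auto simp: \<beta>_def)
    have "16 * B \<le> \<epsilon> * real N" using N(2) \<open>\<epsilon> > 0\<close> by (simp add: field_simps)
    then have "16 * B * r \<le> \<epsilon> * real N * real N"
    proof (rule mult_mono)
      show "r \<le> real N" using r(1) unfolding r(2)[symmetric] by (simp add: power2_eq_square)
    qed (use \<open>\<epsilon> > 0\<close> r in auto)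
    then have "8 * B / (real N)\<^sup>2 \<le> \<epsilon> / 2 / r"
      using N(1) r(1) by (simp add: field_simps power2_eq_square)
    moreover have "\<alpha> + 8 * \<beta> / (real N)\<^sup>2 = \<epsilon> / 2 / r + 8 * B / (real N)\<^sup>2"
      using N(1) r(1) by (simp add: \<alpha>_def \<beta>_def field_simps)
    ultimately have "\<alpha> + 8 * \<beta> / (real N)\<^sup>2 \<le> \<epsilon> / r" by (simp add: field_simps)
    then show ?case using p(1) order.trans[OF p(2)] by (intro exI[of _ p]) (simp add: r_def)
  qed
qed

lemma lagrange_poly_interpolates:
  assumes "finite X" "card X = m" "0 < m"
  shows "degree (lagrange_poly m X f) < m"
    and "x \<in> X \<Longrightarrow> poly (lagrange_poly m X f) (of_real x) = f x"
proof -
  let ?X = "complex_of_real ` X"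
  have X: "finite ?X" "?X \<noteq> {}" and card: "card ?X = m"
    using assms by (auto simp: card_image inj_on_def)
  obtain p where p: "degree p < m" "\<And>x. x \<in> X \<Longrightarrow> poly p (of_real x) = f x"
    using interpolating_poly_exists[OF X, of "\<lambda>z. f (Re z)"] card by auto
  have "degree (lagrange_poly m X f) \<le> m - 1 \<and> (\<forall>x\<in>X. poly (lagrange_poly m X f) (of_real x) = f x)"
    unfolding lagrange_poly_def
  proof (rule theI2[of _ p])
    show "degree p \<le> m - 1 \<and> (\<forall>x\<in>X. poly p (of_real x) = f x)" using p by auto
    show "q = p" if "degree q \<le> m - 1 \<and> (\<forall>x\<in>X. poly q (of_real x) = f x)" for q
      using that p card assms(3) by (intro poly_eqI_degree[of ?X]) auto
  qed
  then show "degree (lagrange_poly m X f) < m" "x \<in> X \<Longrightarrow> poly (lagrange_poly m X f) (of_real x) = f x"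
    using assms(3) by auto
qed

lemma poly_map_poly_Re_Im:
  "poly (map_poly Re p) x = Re (poly p (of_real x))"
  "poly (map_poly Im p) x = Im (poly p (of_real x))"
  by (induction p) (simp_all add: map_poly_pCons)

text \<open>At real points squared moduli add over real and imaginary parts, so complex coefficients
  cost no constant.\<close>

lemma (in endpoint_quadrature) norm_square_le_sum_nodes:
  fixes p :: "complex poly"
  assumes sup: "\<And>m p x. degree p \<le> m \<Longrightarrow> x \<in> {-1..1} \<Longrightarrow> (poly p x)\<^sup>2 \<le> A * real (m + 1) * I (p * p)"
    and peak: "\<And>m y. y \<in> {-1..1} \<Longrightarrow> \<exists>q. degree q \<le> m \<and> poly q y = 1 \<and> I (q * q) \<le> B / real (m + 1)"
    and "0 \<le> A" "0 \<le> B" "degree p < card X" "x \<in> {-1..1}"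
  shows "(cmod (poly p (of_real x)))\<^sup>2 \<le> 2 * A * B * (\<Sum>y\<in>X. (cmod (poly p (of_real y)))\<^sup>2)"
proof -
  have "degree (map_poly Re p) < card X" "degree (map_poly Im p) < card X"
    by (auto intro!: order.strict_trans1[OF degree_map_poly_le] assms(5))
  moreover have "(poly r x)\<^sup>2 \<le> 2 * A * B * (\<Sum>y\<in>X. (poly r y)\<^sup>2)" if "degree r < card X" for r
    by (rule square_le_sum_nodes[OF _ _ assms(3,4) that assms(6)]) (rule sup peak; assumption)+
  ultimately have "(poly (map_poly Re p) x)\<^sup>2 + (poly (map_poly Im p) x)\<^sup>2 \<le>
    2 * A * B * (\<Sum>y\<in>X. (poly (map_poly Re p) y)\<^sup>2) + 2 * A * B * (\<Sum>y\<in>X. (poly (map_poly Im p) y)\<^sup>2)"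
    by (intro add_mono)
  then show ?thesis
    by (simp add: cmod_power2 poly_map_poly_Re_Im sum.distrib ring_distribs)
qed

section \<open>The moment functional of the weight\<close>

locale weight_function =
  fixes w :: "real \<Rightarrow> real"
  assumes meas: "w \<in> borel_measurable (restrict_space borel {-1..1})"
    and nonneg: "\<And>x. x \<in> {-1..1} \<Longrightarrow> 0 \<le> w x"
    and finite: "finite_measure (weight_measure w)"
    and AE_pos: "AE x in Icc_measure. 0 < w x"
begin

definition "moment p = (\<integral>x. poly p x \<partial>weight_measure w)" for p :: "real poly"

lemma w_measurable [measurable]: "w \<in> borel_measurable Icc_measure"
  using meas by (simp cong: measurable_cong_sets sets_restrict_space_cong)

lemma space_weight [simp]: "space (weight_measure w) = {-1..1}"
  by (simp add: weight_measure_def space_restrict_space)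

lemma poly_measurable [measurable]:
  "poly p \<in> borel_measurable Icc_measure" "poly p \<in> borel_measurable (weight_measure w)" for p :: "real poly"
  by (simp_all add: weight_measure_def measurable_restrict_space1 borel_measurable_poly)

lemma integrable_poly: "integrable (weight_measure w) (poly p)" for p :: "real poly"
proof -
  interpret finite_measure "weight_measure w" by (rule finite)
  obtain B where "\<And>x. x \<in> {-1..1} \<Longrightarrow> \<bar>poly p x\<bar> \<le> B" using poly_bounded_Icc by blast
  then show ?thesis by (intro integrable_const_bound[of _ B]) auto
qed

lemma AE_nonneg: "AE x in Icc_measure. 0 \<le> w x"
  using nonneg by (intro AE_I2) (auto simp: space_restrict_space)

lemma moment_eq: "moment p = (\<integral>x. w x * poly p x \<partial>Icc_measure)"
  unfolding moment_def weight_measure_def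
  by (subst integral_density) (use AE_nonneg in auto)

lemma integrable_weight_poly: "integrable Icc_measure (\<lambda>x. w x * poly p x)"
  using integrable_poly[of p] AE_nonneg unfolding weight_measure_def
  by (subst (asm) integrable_density) auto

sublocale positive_functional moment
proof
  show "moment (p + q) = moment p + moment q" for p q
    by (simp add: moment_def Bochner_Integration.integral_add integrable_poly)
  show "moment (smult c p) = c * moment p" for c p
    by (simp add: moment_def)
  show "0 < moment p" if p: "p \<noteq> 0" "\<And>x. x \<in> {-1..1} \<Longrightarrow> 0 \<le> poly p x" for p
  proof -
    have nn: "AE x in Icc_measure. 0 \<le> w x * poly p x"
      using nonneg p(2) by (intro AE_I2) (auto simp: space_restrict_space)
    then have "0 \<le> moment p" unfolding moment_eq by (rule integral_nonneg_AE)
    moreover have "moment p \<noteq> 0"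
    proof
      assume "moment p = 0"
      then have "AE x in Icc_measure. w x * poly p x = 0"
        using integral_nonneg_eq_0_iff_AE[OF integrable_weight_poly nn] by (simp add: moment_eq)
      \<comment> \<open>A nonzero polynomial has finitely many zeros, so vanishing almost everywhere
        would make the interval a null set.\<close>
      then have "AE x in Icc_measure. poly p x = 0" using AE_pos by eventually_elim auto
      then have "AE x in lborel. x \<in> {-1..1} \<longrightarrow> poly p x = 0"
        by (simp add: AE_restrict_space_iff)
      moreover have "AE x in lborel. x \<notin> {x. poly p x = 0}"
        using poly_roots_finite[OF p(1)] by (intro AE_not_in finite_imp_null_set_lborel)
      ultimately have "AE x in lborel. x \<notin> {-1..1::real}" by eventually_elim auto
      then have "{-1..1::real} \<in> null_sets lborel" by (subst AE_iff_null_sets) auto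
      then show False by (simp add: null_sets_def)
    qed
    ultimately show ?thesis by simp
  qed
qed

lemma moment_endpoint_density:
  assumes "E \<subseteq> {1, -1}"
  shows "(\<integral>x. poly p x * poly q x \<partial>density (weight_measure w) (\<lambda>x. ennreal (poly (endpoint_factor E) x))) =
    moment (endpoint_factor E * p * q)"
proof -
  have "(\<integral>x. poly p x * poly q x \<partial>density (weight_measure w) (\<lambda>x. ennreal (poly (endpoint_factor E) x))) =
    (\<integral>x. poly (endpoint_factor E) x *\<^sub>R (poly p x * poly q x) \<partial>weight_measure w)"
    using endpoint_factor_nonneg[OF assms] by (intro integral_density) (auto intro!: AE_I2)
  also have "\<dots> = moment (endpoint_factor E * p * q)"
    unfolding moment_def by (intro Bochner_Integration.integral_cong) simp_all
  finally show ?thesis .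
qed

text \<open>Positivity of the modified functional makes the definite description in
  \<open>monic_orthogonal_poly\<close> proper; orthogonality is then restated in terms of
  \<mu>1.\<close>

lemma monic_orthogonal_poly_props:
  assumes "E \<subseteq> {1, -1}"
    and "M = density (weight_measure w) (\<lambda>x. ennreal (poly (endpoint_factor E) x))"
  defines "P \<equiv> \<lambda>n. monic_orthogonal_poly M n"
  shows "degree (P n) = n" "lead_coeff (P n) = 1"
    "degree q < n \<Longrightarrow> moment (endpoint_factor E * P n * q) = 0"
proof -
  interpret E: positive_functional "\<lambda>p. moment (endpoint_factor E * p)"
    by (rule positive_functional_endpoint[OF assms(1)])
  have eq: "is_monic_orthogonal_poly M n p \<longleftrightarrow>
    degree p = n \<and> lead_coeff p = 1 \<and> (\<forall>q. degree q < n \<longrightarrow> moment (endpoint_factor E * (p * q)) = 0)" for p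
    unfolding is_monic_orthogonal_poly_def assms(2) moment_endpoint_density[OF assms(1)] by (simp add: mult.assoc)
  have "is_monic_orthogonal_poly M n (P n)"
    unfolding P_def monic_orthogonal_poly_def
    by (rule theI') (use E.monic_orthogonal_ex1[of n] in \<open>simp add: eq\<close>)
  then show "degree (P n) = n" "lead_coeff (P n) = 1"
    "degree q < n \<Longrightarrow> moment (endpoint_factor E * P n * q) = 0"
    by (auto simp: eq mult.assoc)
qed

lemma moment_cheb_integral_bounds:
  assumes "\<And>x. x \<in> {-1<..<1} \<Longrightarrow> c \<le> w x * sqrt (1 - x\<^sup>2) \<and> w x * sqrt (1 - x\<^sup>2) \<le> C"
    and p: "\<And>x. x \<in> {-1..1} \<Longrightarrow> 0 \<le> poly p x"
  shows "c * cheb_integral p \<le> moment p" "moment p \<le> C * cheb_integral p"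
proof -
  \<comment> \<open>The bounds are given only in the open interval; the endpoints form a null
    set.\<close>
  have "AE x in lborel. x \<noteq> (1::real)" "AE x in lborel. x \<noteq> (-1::real)"
    by (auto intro: AE_lborel_singleton)
  then have "AE x in lborel. x \<in> {-1..1} \<longrightarrow>
      c * (poly p x * (1 / sqrt (1 - x\<^sup>2))) \<le> w x * poly p x \<and> w x * poly p x \<le> C * (poly p x * (1 / sqrt (1 - x\<^sup>2)))"
  proof eventually_elim
    case (elim x)
    show ?case
    proof
      assume "x \<in> {-1..1}"
      then have x: "x \<in> {-1<..<1}" "0 \<le> poly p x" and "0 < sqrt (1 - x\<^sup>2)"
        using elim p one_minus_sq_pos[of x] by auto
      then have "c * (1 / sqrt (1 - x\<^sup>2)) \<le> w x" "w x \<le> C * (1 / sqrt (1 - x\<^sup>2))"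
        using assms(1)[OF x(1)] by (auto simp: field_simps)
      from this[THEN mult_right_mono, OF x(2)]
      show "c * (poly p x * (1 / sqrt (1 - x\<^sup>2))) \<le> w x * poly p x \<and> w x * poly p x \<le> C * (poly p x * (1 / sqrt (1 - x\<^sup>2)))"
        by (simp add: mult.commute)
    qed
  qed
  then have AE: "AE x in Icc_measure. c * (poly p x * (1 / sqrt (1 - x\<^sup>2))) \<le> w x * poly p x"
    "AE x in Icc_measure. w x * poly p x \<le> C * (poly p x * (1 / sqrt (1 - x\<^sup>2)))"
    by (auto simp: AE_restrict_space_iff elim: eventually_mono)
  have int: "integrable Icc_measure (\<lambda>x. d * (poly p x * (1 / sqrt (1 - x\<^sup>2))))" for d
    using integrable_poly_cheb_weight[of p] by (rule integrable_mult_right)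
  show "c * cheb_integral p \<le> moment p" "moment p \<le> C * cheb_integral p"
    unfolding cheb_integral_def moment_eq Bochner_Integration.integral_mult_right_zero[symmetric]
    by (rule integral_mono_AE[OF int integrable_weight_poly AE(1)])
      (rule integral_mono_AE[OF integrable_weight_poly int AE(2)])
qed

lemma interpolation_converges:
  assumes f: "continuous_on {-1..1} f" "modulus_cont f \<in> o[at_right 0](\<lambda>\<delta>. \<delta> powr (1/2))"
    and bounds: "0 < c" "\<And>x. x \<in> {-1<..<1} \<Longrightarrow> c \<le> w x * sqrt (1 - x\<^sup>2) \<and> w x * sqrt (1 - x\<^sup>2) \<le> C"
    and E: "E \<subseteq> {1, -1}" "E \<noteq> {}"
    and M: "M = density (weight_measure w) (\<lambda>x. ennreal (poly (endpoint_factor E) x))"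
  shows "uniform_limit {-1..1}
    (\<lambda>n x. poly (lagrange_poly (n + card E) (poly_zeros (monic_orthogonal_poly M n) \<union> E) f) (of_real x))
    f sequentially"
proof (rule uniform_limitI)
  fix e :: real assume "e > 0"
  \<comment> \<open>The constants of \<open>square_le_cheb_integral\<close> and
    \<open>cheb_peak_exists\<close>, adjusted by the comparison constants \<open>c\<close> and
    \<open>C\<close>.\<close>
  define A where "A = 2 / (pi * c)"
  define B where "B = 4 * pi * C"
  have "0 < C" using bounds(1) bounds(2)[of 0] by simp
  have A: "0 \<le> A" and B: "0 \<le> B" using \<open>0 < c\<close> \<open>0 < C\<close> by (simp_all add: A_def B_def)
  have sup: "(poly p x)\<^sup>2 \<le> A * real (m + 1) * moment (p * p)" if "degree p \<le> m" "x \<in> {-1..1}" for m p x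
  proof -
    have "(poly p x)\<^sup>2 \<le> 2 / pi * real (m + 1) * cheb_integral (p * p)" by (rule square_le_cheb_integral[OF that])
    also have "\<dots> = A * real (m + 1) * (c * cheb_integral (p * p))"
      using \<open>0 < c\<close> by (simp add: A_def)
    also have "\<dots> \<le> A * real (m + 1) * moment (p * p)"
      using moment_cheb_integral_bounds(1)[OF bounds(2), of "p * p"] A by (intro mult_left_mono) auto
    finally show ?thesis .
  qed
  have peak: "\<exists>q. degree q \<le> m \<and> poly q y = 1 \<and> moment (q * q) \<le> B / real (m + 1)" if y: "y \<in> {-1..1}" for m y
  proof -
    obtain q where q: "degree q \<le> m" "poly q y = 1" "cheb_integral (q * q) \<le> 4 * pi / real (m + 1)"
      using cheb_peak_exists[OF y] by blast
    have "moment (q * q) \<le> C * cheb_integral (q * q)"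
      by (rule moment_cheb_integral_bounds(2)[OF bounds(2)]) auto
    also have "\<dots> \<le> C * (4 * pi / real (m + 1))" using q(3) \<open>0 < C\<close> by (intro mult_left_mono) auto
    finally show ?thesis using q(1,2) by (intro exI[of _ q]) (simp add: B_def mult_ac)
  qed
  \<comment> \<open>At most 3 N nodes each contribute at most \<epsilon>^2 / N, so 2 A B times their
    sum is at most (K \<epsilon>)^2.\<close>
  define K where "K = sqrt (6 * A * B)"
  have "K \<ge> 0" using A B by (simp add: K_def)
  define \<epsilon> where "\<epsilon> = e / (2 * (1 + K))"
  have "\<epsilon> > 0" using \<open>e > 0\<close> \<open>K \<ge> 0\<close> by (simp add: \<epsilon>_def)
  have lim: "filterlim (\<lambda>n::nat. n div 2 + 1) sequentially sequentially"
    unfolding filterlim_at_top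
  proof
    fix Z :: nat
    show "\<forall>\<^sub>F n in sequentially. Z \<le> n div 2 + 1"
      by (rule eventually_sequentiallyI[of "2 * Z"]) linarith
  qed
  have "\<forall>\<^sub>F n in sequentially. \<exists>p. degree p \<le> 2 * (n div 2 + 1) - 2 \<and>
    (\<forall>x\<in>{-1..1}. cmod (poly p (of_real x) - f x) \<le> \<epsilon> / sqrt (real (n div 2 + 1)))"
    by (rule eventually_compose_filterlim[OF jackson_little_o[OF f \<open>\<epsilon> > 0\<close>] lim])
  then show "\<forall>\<^sub>F n in sequentially. \<forall>x\<in>{-1..1}.
    dist (poly (lagrange_poly (n + card E) (poly_zeros (monic_orthogonal_poly M n) \<union> E) f) (of_real x)) (f x) < e"
  proof eventually_elim
    case (elim n)
    \<comment> \<open>The degree 2N - 2 \<le> n is reproduced by the interpolation, and N is still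
      large enough that n + 2 \<le> 3 N.\<close>
    define N where "N = n div 2 + 1"
    define \<eta> where "\<eta> = \<epsilon> / sqrt (real N)"
    obtain p where "degree p \<le> 2 * N - 2"
      and approx: "\<forall>x\<in>{-1..1}. cmod (poly p (of_real x) - f x) \<le> \<eta>"
      using elim unfolding N_def \<eta>_def by blast
    moreover have N: "2 * N - 2 \<le> n" "n \<le> 2 * N - 1" "1 \<le> N" by (auto simp: N_def)
    ultimately have "degree p \<le> n" by linarith
    note p = this approx[rule_format]
    let ?P = "monic_orthogonal_poly M n"
    note P = monic_orthogonal_poly_props[OF E(1) M, where n = n]
    interpret Q: endpoint_quadrature moment E ?P
      by unfold_locales (use E P in auto)
    have nodes: "poly_zeros ?P \<union> E = Q.X" by (simp add: Q.X_def poly_zeros_def)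
    have card: "card Q.X = n + card E" using Q.card_X P(1) by simp
    define L where "L = lagrange_poly (n + card E) Q.X f"
    have L: "degree L < card Q.X" "\<And>x. x \<in> Q.X \<Longrightarrow> poly L (of_real x) = f x"
      using lagrange_poly_interpolates[OF Q.finite_X card] Q.card_X_pos card by (auto simp: L_def)
    have "card E > 0" using Q.finite_E E(2) by (simp add: card_gt_0_iff)
    then have "degree (L - p) < card Q.X"
      using L(1) p(1) card by (intro degree_diff_less) auto
    have "card E \<le> 2" using card_mono[OF _ E(1)] by simp
    then have "card Q.X \<le> 3 * N" unfolding card using N by linarith
    \<comment> \<open>At the nodes L - p coincides with f - p.\<close>
    have node_bound: "(cmod (poly (L - p) (of_real y)))\<^sup>2 \<le> \<eta>\<^sup>2" if "y \<in> Q.X" for y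
      using p(2)[of y] that Q.X_subset L(2)[OF that] by (intro power_mono) (auto simp: norm_minus_commute)
    have "dist (poly L (of_real x)) (f x) < e" if x: "x \<in> {-1..1}" for x
    proof -
      have "(cmod (poly (L - p) (of_real x)))\<^sup>2 \<le> 2 * A * B * (\<Sum>y\<in>Q.X. (cmod (poly (L - p) (of_real y)))\<^sup>2)"
        by (rule Q.norm_square_le_sum_nodes[OF _ _ A B \<open>degree (L - p) < card Q.X\<close> x])
          (rule sup peak; assumption)+
      also have "\<dots> \<le> 2 * A * B * (\<Sum>y\<in>Q.X. \<eta>\<^sup>2)"
        using A B node_bound by (intro mult_left_mono sum_mono) auto
      also have "\<dots> \<le> 2 * A * B * (3 * real N * \<eta>\<^sup>2)"
        using A B \<open>card Q.X \<le> 3 * N\<close> by (intro mult_left_mono) (auto intro!: mult_right_mono)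
      also have "\<dots> = 6 * A * B * (real N * \<eta>\<^sup>2)" by simp
      also have "real N * \<eta>\<^sup>2 = \<epsilon>\<^sup>2" using N(3) by (simp add: \<eta>_def power_divide)
      also have "6 * A * B * \<epsilon>\<^sup>2 = (K * \<epsilon>)\<^sup>2" using A B by (simp add: K_def power_mult_distrib)
      finally have "cmod (poly (L - p) (of_real x)) \<le> K * \<epsilon>"
        by (rule power2_le_imp_le) (use \<open>K \<ge> 0\<close> \<open>\<epsilon> > 0\<close> in simp)
      moreover have "\<epsilon> / sqrt (real N) \<le> \<epsilon> / 1"
        using \<open>\<epsilon> > 0\<close> N(3) by (intro divide_left_mono) auto
      then have "\<eta> \<le> \<epsilon>" by (simp add: \<eta>_def)
      ultimately have "cmod (poly (L - p) (of_real x)) + cmod (poly p (of_real x) - f x) \<le> (1 + K) * \<epsilon>"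
        using p(2)[OF x] by (simp add: ring_distribs)
      also have "\<dots> = e / 2"
      proof -
        have "1 + K \<noteq> 0" using \<open>K \<ge> 0\<close> by linarith
        then show ?thesis unfolding \<epsilon>_def by (simp add: divide_simps)
      qed
      finally have "cmod (poly (L - p) (of_real x)) + cmod (poly p (of_real x) - f x) < e"
        using \<open>e > 0\<close> by linarith
      then show ?thesis
        using norm_triangle_ineq[of "poly (L - p) (of_real x)" "poly p (of_real x) - f x"]
        by (simp add: dist_norm)
    qed
    then show ?case by (simp add: nodes L_def)
  qed
qed

end

theorem theorem5:
  fixes f :: "real \<Rightarrow> complex" and w :: "real \<Rightarrow> real"
    and h :: "complex \<Rightarrow> complex" and U :: "complex set"
    and \<mu>1 \<mu>2 \<mu>3 \<mu>4 :: "real measure"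
  assumes f_cont: "continuous_on {-1..1} f"
    and f_mod: "modulus_cont f \<in> o[at_right 0](\<lambda>\<delta>. \<delta> powr (1/2))"
    and w_meas: "w \<in> borel_measurable (restrict_space borel {-1..1})"
    and w_nonneg: "\<And>x. x \<in> {-1..1} \<Longrightarrow> 0 \<le> w x"
    and \<mu>1: "\<mu>1 = weight_measure w"
    and \<mu>1_finite: "finite_measure \<mu>1"
    and szego: "szego_condition w"
    and U_open: "open U"
    and U_contains: "complex_of_real ` {-1..1} \<subseteq> U"
    and h_analytic: "h analytic_on U"
    and h_pos: "\<And>x. x \<in> {-1..1} \<Longrightarrow> h (complex_of_real x) \<in> \<real> \<and> 0 < Re (h (complex_of_real x))"
    and h_w: "\<And>x. x \<in> {-1<..<1} \<Longrightarrow>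
                h (complex_of_real x) = complex_of_real (w x * sqrt (1 - x\<^sup>2))"
    and \<mu>2: "\<mu>2 = density \<mu>1 (\<lambda>x. ennreal (1 - x\<^sup>2))"
    and \<mu>3: "\<mu>3 = density \<mu>1 (\<lambda>x. ennreal (1 - x))"
    and \<mu>4: "\<mu>4 = density \<mu>1 (\<lambda>x. ennreal (1 + x))"
  shows "uniform_limit {-1..1}
           (\<lambda>n x. poly (lagrange_poly (n + 2)
              (poly_zeros (monic_orthogonal_poly \<mu>2 n) \<union> {1, -1}) f) (complex_of_real x))
           f sequentially
       \<and> uniform_limit {-1..1}
           (\<lambda>n x. poly (lagrange_poly (n + 1)
              (poly_zeros (monic_orthogonal_poly \<mu>3 n) \<union> {1}) f) (complex_of_real x))
           f sequentially
       \<and> uniform_limit {-1..1}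
           (\<lambda>n x. poly (lagrange_poly (n + 1)
              (poly_zeros (monic_orthogonal_poly \<mu>4 n) \<union> {-1}) f) (complex_of_real x))
           f sequentially"
proof -
  interpret weight_function w
    by (rule weight_function.intro[OF w_meas w_nonneg \<mu>1_finite[unfolded \<mu>1]])
      (use szego in \<open>simp_all only: szego_condition_def\<close>)
  let ?g = "\<lambda>x. Re (h (complex_of_real x))"
  have "continuous_on U h"
    by (rule holomorphic_on_imp_continuous_on[OF analytic_imp_holomorphic[OF h_analytic]])
  then have cont: "continuous_on {-1..1} ?g"
    using U_contains
    by (intro continuous_on_Re continuous_on_compose2[of U h "{-1..1}" complex_of_real] continuous_intros)
  \<comment> \<open>The function h extends w(x) sqrt (1 - x^2) continuously and positively to the
    endpoints; compactness then supplies both constants of the comparison.\<close>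
  obtain a where a: "a \<in> {-1..1}" "\<And>x. x \<in> {-1..1} \<Longrightarrow> ?g a \<le> ?g x"
    using continuous_attains_inf[OF compact_Icc _ cont] by auto
  obtain b where b: "\<forall>x\<in>{-1..1}. ?g x \<le> ?g b"
    using continuous_attains_sup[OF compact_Icc _ cont] by auto
  have pos: "0 < ?g a" using h_pos[OF a(1)] by simp
  have bounds: "?g a \<le> w x * sqrt (1 - x\<^sup>2) \<and> w x * sqrt (1 - x\<^sup>2) \<le> ?g b" if "x \<in> {-1<..<1}" for x
    using a(2)[of x] bspec[OF b, of x] that h_w[OF that] by auto
  note conv = interpolation_converges[OF f_cont f_mod pos bounds]
  have factors: "poly (endpoint_factor {1, -1}) = (\<lambda>x. 1 - x\<^sup>2)" "poly (endpoint_factor {1}) = (\<lambda>x. 1 - x)"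
    "poly (endpoint_factor {-1}) = (\<lambda>x. 1 + x)"
    by (auto simp: endpoint_factor_def fun_eq_iff power2_eq_square algebra_simps)
  show ?thesis
    using conv[of "{1, -1}" \<mu>2] conv[of "{1}" \<mu>3] conv[of "{-1}" \<mu>4]
    by (simp add: factors \<mu>1 \<mu>2 \<mu>3 \<mu>4)
qed

end
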